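(* Let $H$ be a locally compact second countable group with left Haar measure $m_H$ and a proper left-invariant metric $d$, and assume $(H,d)$ has sub-exponential growth, i.e. $\limsup_{r\to\infty} \frac{\log m_H(B_d(e,r))}{r}=0$, where $B_d(e,r)$ is the $d$-ball of radius $r$ about the identity $e$. Let $(F_T)$ be a right Følner sequence in $H$ with $m_H(F_T)\to\infty$. Suppose $H$ acts on a probability space $(X,\mu)$ and this action is exponentially mixing of all orders on an $H$-invariant subalgebra $\mathcal{A}$ of $L^\infty(X,\mu)$ with respect to $d$ and a family of seminorms $(N_s)$ as described in the context. Then for every $f\in\mathcal{A}$ with $\mu(f)=0$, $$\frac{1}{m_H(F_T)^{1/2}}\int_{F_T} (f\circ h^{-1})\,dm_H(h)\implies N(0,\sigma_f^2)\quad\text{as } T\to\infty,$$ where $\sigma_f^2=\int_H \langle f, f\circ h^{-1}\rangle\,dm_H(h)$, and $\implies$ denotes convergence in distribution of functions on $(X,\mu)$.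
   Context: A sequence $(F_T)$ of compact subsets of $H$ with non-empty interior is right Følner if $m_H(F_T\triangle F_Th)/m_H(F_T)\to 0$ for all $h\in H$. The action of $H$ on $(X,\mu)$ is jointly measurable and measure-preserving; $H$ acts on functions by $h\cdot f=f\circ h^{-1}$. $\mathcal{A}\subset L^\infty(X,\mu)$ is an $H$-invariant subalgebra and $(N_s)_{s\ge1}$ is a family of seminorms on $\mathcal{A}$ such that for all $s\ge1$, all $f,f_1,f_2\in\mathcal{A}$ and $h\in H$ (implied constants depending only on $s$): $N_s(f)\ll N_{s+1}(f)$; $\|f\|_{L^\infty}\ll N_s(f)$; there is $\sigma_s>0$ with $N_s(h\cdot f)\ll e^{\sigma_s d(h,e)}N_s(f)$; and $N_s(f_1f_2)\ll N_{s+1}(f_1)N_{s+1}(f_2)$. Exponential mixing of all orders means: for every integer $r\ge2$ there exist $\delta_r>0$ and an integer $s_r>0$ such that for all $s>s_r$, all $f_1,\dots,f_r\in\mathcal{A}$ and all $h_1,\dots,h_r\in H$, $$\Big|\mu\Big(\prod_{i=1}^r h_i\cdot f_i\Big)-\prod_{i=1}^r\mu(f_i)\Big|\le C_{r,s}\, e^{-\delta_r \min_{i\ne j} d(h_i,h_j)}\prod_{i=1}^r N_s(f_i),$$ with $C_{r,s}$ depending only on $r,s$. *)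

theory Defs
  imports "HOL-Probability.Probability"
begin

text \<open>The group H is written additively (class group_add, which is NOT assumed commutative):
  identity 0, product g + h, inverse - g.\<close>

definition group_action :: "('h::group_add \<Rightarrow> 'x \<Rightarrow> 'x) \<Rightarrow> bool" where
  "group_action act \<longleftrightarrow> (\<forall>x. act 0 x = x) \<and> (\<forall>g h x. act (g + h) x = act g (act h x))"

definition trans_fun :: "('h::group_add \<Rightarrow> 'x \<Rightarrow> 'x) \<Rightarrow> 'h \<Rightarrow> ('x \<Rightarrow> real) \<Rightarrow> ('x \<Rightarrow> real)" where
  "trans_fun act h f = (\<lambda>x. f (act (- h) x))"

definition left_haar :: "'h::{topological_space, group_add} measure \<Rightarrow> bool" where
  "left_haar m \<longleftrightarrow> sets m = sets borel
     \<and> (\<forall>g A. A \<in> sets borel \<longrightarrow> emeasure m ((\<lambda>x. g + x) ` A) = emeasure m A)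
     \<and> (\<forall>K. compact K \<longrightarrow> emeasure m K < \<infinity>)
     \<and> (\<forall>U. open U \<and> U \<noteq> {} \<longrightarrow> emeasure m U > 0)"

definition right_folner :: "'h::{topological_space, group_add} measure \<Rightarrow> (nat \<Rightarrow> 'h set) \<Rightarrow> bool" where
  "right_folner m F \<longleftrightarrow> (\<forall>T. compact (F T) \<and> interior (F T) \<noteq> {})
     \<and> (\<forall>h. ((\<lambda>T. measure m ((F T - (\<lambda>x. x + h) ` F T) \<union> ((\<lambda>x. x + h) ` F T - F T))
                    / measure m (F T)) \<longlongrightarrow> 0) sequentially)"

definition inv_subalgebra :: "'x measure \<Rightarrow> ('h::group_add \<Rightarrow> 'x \<Rightarrow> 'x) \<Rightarrow> ('x \<Rightarrow> real) set \<Rightarrow> bool" where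
  "inv_subalgebra M act A \<longleftrightarrow> A \<subseteq> borel_measurable M
     \<and> (\<forall>f\<in>A. \<forall>g\<in>A. (\<lambda>x. f x + g x) \<in> A \<and> (\<lambda>x. f x * g x) \<in> A)
     \<and> (\<forall>f\<in>A. \<forall>c. (\<lambda>x. c * f x) \<in> A)
     \<and> (\<forall>f\<in>A. \<forall>h. trans_fun act h f \<in> A)"

definition adm_seminorms :: "'x measure \<Rightarrow> ('h::{metric_space, group_add} \<Rightarrow> 'x \<Rightarrow> 'x)
     \<Rightarrow> ('x \<Rightarrow> real) set \<Rightarrow> (nat \<Rightarrow> ('x \<Rightarrow> real) \<Rightarrow> real) \<Rightarrow> bool" where
  "adm_seminorms M act A N \<longleftrightarrow>
     (\<forall>s\<ge>1. \<forall>f\<in>A. \<forall>g\<in>A. \<forall>c. N s f \<ge> 0 \<and> N s (\<lambda>x. f x + g x) \<le> N s f + N s g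
                              \<and> N s (\<lambda>x. c * f x) = \<bar>c\<bar> * N s f)
   \<and> (\<forall>s\<ge>1. \<exists>C. \<forall>f\<in>A. N s f \<le> C * N (s + 1) f)
   \<and> (\<forall>s\<ge>1. \<exists>C. \<forall>f\<in>A. AE x in M. \<bar>f x\<bar> \<le> C * N s f)
   \<and> (\<forall>s\<ge>1. \<exists>\<sigma>>0. \<exists>C. \<forall>f\<in>A. \<forall>h. N s (trans_fun act h f) \<le> C * exp (\<sigma> * dist h 0) * N s f)
   \<and> (\<forall>s\<ge>1. \<exists>C. \<forall>f1\<in>A. \<forall>f2\<in>A. N s (\<lambda>x. f1 x * f2 x) \<le> C * N (s + 1) f1 * N (s + 1) f2)"

definition exp_mixing_all_orders :: "'x measure \<Rightarrow> ('h::{metric_space, group_add} \<Rightarrow> 'x \<Rightarrow> 'x)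
     \<Rightarrow> ('x \<Rightarrow> real) set \<Rightarrow> (nat \<Rightarrow> ('x \<Rightarrow> real) \<Rightarrow> real) \<Rightarrow> bool" where
  "exp_mixing_all_orders M act A N \<longleftrightarrow>
     (\<forall>r::nat. r \<ge> 2 \<longrightarrow> (\<exists>\<delta>::real>0. \<exists>sr::nat>0. \<forall>s>sr. \<exists>C::real.
        \<forall>(fs :: nat \<Rightarrow> 'x \<Rightarrow> real) (hs :: nat \<Rightarrow> 'h). (\<forall>i<r. fs i \<in> A) \<longrightarrow>
          \<bar>(\<integral>x. (\<Prod>i<r. trans_fun act (hs i) (fs i) x) \<partial>M) - (\<Prod>i<r. \<integral>x. fs i x \<partial>M)\<bar>
            \<le> C * exp (- \<delta> * Min {dist (hs i) (hs j) | i j. i < r \<and> j < r \<and> i \<noteq> j})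
                * (\<Prod>i<r. N s (fs i))))"

definition normal_law :: "real \<Rightarrow> real measure" where
  "normal_law v = (if v > 0 then density lborel (normal_density 0 (sqrt v)) else return borel 0)"

end

theory Submission
  imports Defs
begin

text \<open>
  The moments of the normalized orbit integrals are shown to satisfy, in the limit, the recursion
  \<open>M\<^sub>r = (r - 1) \<sigma>\<^sup>2 M\<^bsub>r-2\<^esub>\<close> of the moments of the normal law. The moment of order r is the integral
  over tuples of elements of F of the r-point correlation. By the pigeonhole principle, among the
  geometric scales D, K D, K^2 D, ... with D of order log (m F) there is one such that no two
  points of a given tuple have distance in the band between it and the next. At this scale the
  tuple splits into clusters of diameter at most the scale that are separated by K times the
  scale. Applying exponential mixing to the products of f over the clusters, whose seminorms grow
  exponentially in the diameter, shows that for large K the correlation is the product of the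
  correlations of the clusters, up to an error that is a large negative power of m F. A one-point
  cluster makes the correlation negligible since f has mean zero. If there is none and the cluster
  of the first point is a pair, this pair splits off, which gives the main term. All other tuples
  have at most (r - 1) / 2 clusters, and by subexponential growth they fill a set of measure
  (m F)^((r - 1) / 2 + o(1)), which is negligible compared to (m F)^(r / 2).
\<close>

subsection \<open>Method of moments for the normal law\<close>

definition char_taylor :: "real measure \<Rightarrow> nat \<Rightarrow> real \<Rightarrow> complex" where
  "char_taylor \<mu> K t = (\<Sum>k\<le>2 * K. (\<i> * t) ^ k / fact k * (\<integral>x. x ^ k \<partial>\<mu>))"

definition char_remainder :: "real measure \<Rightarrow> nat \<Rightarrow> real \<Rightarrow> real" where
  "char_remainder \<mu> K t = 2 * (t ^ (2 * K) / fact (2 * K) * (\<integral>x. x ^ (2 * K) \<partial>\<mu>))"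

lemma (in real_distribution) char_taylor_approx:
  assumes "\<And>k. integrable M (\<lambda>x. x ^ k)"
  shows "cmod (char M t - char_taylor M K t) \<le> char_remainder M K t"
  using char_approx1[of "2 * K" t] assms
  by (simp add: char_taylor_def char_remainder_def power_even_abs)

lemma weak_conv_m_of_moments:
  fixes \<mu> :: "nat \<Rightarrow> real measure" and \<nu> :: "real measure"
  assumes \<mu>: "\<And>n. real_distribution (\<mu> n)" and \<nu>: "real_distribution \<nu>"
    and int_\<mu>: "\<And>n k. integrable (\<mu> n) (\<lambda>x. x ^ k)" and int_\<nu>: "\<And>k. integrable \<nu> (\<lambda>x. x ^ k)"
    and moments: "\<And>k. (\<lambda>n. \<integral>x. x ^ k \<partial>\<mu> n) \<longlonglongrightarrow> (\<integral>x. x ^ k \<partial>\<nu>)"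
    and tail: "\<And>t. (\<lambda>K. char_remainder \<nu> K t) \<longlonglongrightarrow> 0"
  shows "weak_conv_m \<mu> \<nu>"
proof (rule levy_continuity[OF \<mu> \<nu>])
  fix t :: real
  let ?taylor = "\<lambda>\<rho> K. char_taylor \<rho> K t" and ?remainder = "\<lambda>\<rho> K. char_remainder \<rho> K t"
  show "(\<lambda>n. char (\<mu> n) t) \<longlonglongrightarrow> char \<nu> t"
  proof (rule tendstoI)
    fix e :: real
    assume "e > 0"
    then obtain K where K: "?remainder \<nu> K < e / 2"
      using order_tendstoD(2)[OF tail, of "e / 2" t] unfolding eventually_sequentially by auto
    have "(\<lambda>n. cmod (?taylor (\<mu> n) K - ?taylor \<nu> K) + ?remainder (\<mu> n) K + ?remainder \<nu> K)
        \<longlonglongrightarrow> cmod (?taylor \<nu> K - ?taylor \<nu> K) + ?remainder \<nu> K + ?remainder \<nu> K"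
      unfolding char_taylor_def char_remainder_def by (intro tendsto_intros moments)
    then have "\<forall>\<^sub>F n in sequentially.
        cmod (?taylor (\<mu> n) K - ?taylor \<nu> K) + ?remainder (\<mu> n) K + ?remainder \<nu> K < e"
      by (rule order_tendstoD) (use K in simp)
    then show "\<forall>\<^sub>F n in sequentially. dist (char (\<mu> n) t) (char \<nu> t) < e"
    proof eventually_elim
      case (elim n)
      have "dist (char (\<mu> n) t) (char \<nu> t) \<le> dist (char (\<mu> n) t) (?taylor (\<mu> n) K)
          + dist (?taylor (\<mu> n) K) (?taylor \<nu> K) + dist (char \<nu> t) (?taylor \<nu> K)"
        by metric
      also have "\<dots> < e"
        using real_distribution.char_taylor_approx[OF \<mu> int_\<mu>, of n t K]
          real_distribution.char_taylor_approx[OF \<nu> int_\<nu>, of t K] elim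
        by (simp add: dist_norm)
      finally show ?case .
    qed
  qed
qed

lemma has_bochner_integral_return:
  fixes g :: "'a \<Rightarrow> 'b::{banach, second_countable_topology}"
  assumes "x \<in> space M" "g \<in> borel_measurable M"
  shows "has_bochner_integral (return M x) g (g x)"
  using assms
  by (simp add: has_bochner_integral_iff integrable_iff_bounded nn_integral_return integral_return)

lemma normal_law_moment_even:
  assumes "v \<ge> 0"
  shows "has_bochner_integral (normal_law v) (\<lambda>x. x ^ (2 * k))
    (fact (2 * k) / fact k * (v / 2) ^ k)"
proof (cases "v > 0")
  case True
  have "has_bochner_integral lborel (\<lambda>x. normal_density 0 (sqrt v) x *\<^sub>R x ^ (2 * k))
      (fact (2 * k) / fact k * (v / 2) ^ k)"
    using normal_moment_even[of "sqrt v" 0 k] True by (simp add: power_divide field_simps)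
  then show ?thesis
    using True by (simp add: normal_law_def has_bochner_integral_density)
next
  case False
  with assms have "v = 0" by simp
  then show ?thesis
    using has_bochner_integral_return[of 0 borel "\<lambda>x::real. x ^ (2 * k)"]
    by (cases k) (simp_all add: normal_law_def)
qed

lemma normal_law_moment_odd:
  assumes "v \<ge> 0"
  shows "has_bochner_integral (normal_law v) (\<lambda>x. x ^ (2 * k + 1)) 0"
proof (cases "v > 0")
  case True
  then show ?thesis
    using normal_moment_odd[of "sqrt v" 0 k]
    by (simp add: normal_law_def has_bochner_integral_density)
next
  case False
  with assms have "v = 0" by simp
  then show ?thesis
    using has_bochner_integral_return[of 0 borel "\<lambda>x::real. x ^ (2 * k + 1)"]
    by (simp add: normal_law_def)
qed

lemma integrable_normal_law_power:
  assumes "v \<ge> 0"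
  shows "integrable (normal_law v) (\<lambda>x. x ^ k)"
proof (cases "even k")
  case True
  then show ?thesis
    using normal_law_moment_even[OF assms] by (metis evenE integrable.intros)
next
  case False
  then show ?thesis
    using normal_law_moment_odd[OF assms] by (metis oddE integrable.intros)
qed

lemma normal_law_moment_recursion:
  assumes "v \<ge> 0"
  shows "(\<integral>x. x ^ Suc (Suc k) \<partial>normal_law v) = real (Suc k) * (v * (\<integral>x. x ^ k \<partial>normal_law v))"
proof (cases "even k")
  case True
  then obtain n where k: "k = 2 * n" by (elim evenE)
  have "(\<integral>x. x ^ (2 * Suc n) \<partial>normal_law v) = fact (2 * Suc n) / fact (Suc n) * (v / 2) ^ Suc n"
    by (rule has_bochner_integral_integral_eq[OF normal_law_moment_even[OF assms]])
  also have "\<dots> = real (Suc k) * (v * (fact (2 * n) / fact n * (v / 2) ^ n))"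
    by (simp add: k divide_simps)
  also have "fact (2 * n) / fact n * (v / 2) ^ n = (\<integral>x. x ^ k \<partial>normal_law v)"
    unfolding k
    by (rule has_bochner_integral_integral_eq[OF normal_law_moment_even[OF assms], symmetric])
  finally show ?thesis by (simp add: k)
next
  case False
  then obtain n where k: "k = 2 * n + 1" by (elim oddE)
  have odd: "(\<integral>x. x ^ (2 * j + 1) \<partial>normal_law v) = 0" for j
    by (rule has_bochner_integral_integral_eq[OF normal_law_moment_odd[OF assms]])
  show ?thesis
    using odd[of n] odd[of "Suc n"] by (simp add: k)
qed

lemma real_distribution_normal_law: "v \<ge> 0 \<Longrightarrow> real_distribution (normal_law v)"
  unfolding normal_law_def real_distribution_def real_distribution_axioms_def
  by (auto intro!: prob_space_normal_density prob_space_return)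

lemma char_remainder_normal_law_tendsto:
  assumes "v \<ge> 0"
  shows "(\<lambda>K. char_remainder (normal_law v) K t) \<longlonglongrightarrow> 0"
proof -
  have "(\<lambda>K. 2 * ((t\<^sup>2 * (v / 2)) ^ K /\<^sub>R fact K)) \<longlonglongrightarrow> 2 * 0"
    by (intro tendsto_intros summable_LIMSEQ_zero summable_exp_generic)
  also have "(\<lambda>K. 2 * ((t\<^sup>2 * (v / 2)) ^ K /\<^sub>R fact K))
      = (\<lambda>K. 2 * (t ^ (2 * K) / fact (2 * K) * (fact (2 * K) / fact K * (v / 2) ^ K)))"
    by (simp add: power_mult_distrib field_simps flip: power_mult)
  finally show ?thesis
    by (simp add: char_remainder_def
        has_bochner_integral_integral_eq[OF normal_law_moment_even[OF assms]])
qed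

lemma (in prob_space) weak_conv_m_normal_law_of_moments:
  fixes X :: "nat \<Rightarrow> 'a \<Rightarrow> real"
  assumes meas[measurable]: "\<And>n. X n \<in> borel_measurable M"
    and int: "\<And>n k. integrable M (\<lambda>x. X n x ^ k)"
    and moments: "\<And>k. (\<lambda>n. expectation (\<lambda>x. X n x ^ k)) \<longlonglongrightarrow> (\<integral>x. x ^ k \<partial>normal_law v)"
    and v: "v \<ge> 0"
  shows "weak_conv_m (\<lambda>n. distr M borel (X n)) (normal_law v)"
proof (rule weak_conv_m_of_moments)
  show "real_distribution (distr M borel (X n))" for n
    by (rule real_distribution_distr) simp
  show "integrable (distr M borel (X n)) (\<lambda>x. x ^ k)" for n k
    using int by (simp add: integrable_distr_eq)
  show "(\<lambda>n. \<integral>x. x ^ k \<partial>distr M borel (X n)) \<longlonglongrightarrow> (\<integral>x. x ^ k \<partial>normal_law v)" for k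
    using moments by (simp add: integral_distr)
qed (intro real_distribution_normal_law integrable_normal_law_power
    char_remainder_normal_law_tendsto v)+

subsection \<open>Clusters of points in a metric space\<close>

lemma exists_geometric_gap:
  fixes S :: "real set"
  assumes "finite S" "card S \<le> n" "K \<ge> 1" "D \<ge> 0"
  shows "\<exists>k\<le>n. \<forall>x\<in>S. x \<le> K ^ k * D \<or> K ^ Suc k * D < x"
proof (rule ccontr)
  assume "\<not> ?thesis"
  then have "\<forall>k. \<exists>x. k \<le> n \<longrightarrow> x \<in> S \<and> K ^ k * D < x \<and> x \<le> K ^ Suc k * D"
    by (metis not_le)
  then obtain x where x: "\<And>k. k \<le> n \<Longrightarrow> x k \<in> S \<and> K ^ k * D < x k \<and> x k \<le> K ^ Suc k * D"
    by metis
  have "inj_on x {..n}"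
  proof (rule linorder_inj_onI)
    fix k l
    assume "k < l" "k \<in> {..n}" "l \<in> {..n}"
    have "x k \<le> K ^ Suc k * D"
      using x \<open>k \<in> {..n}\<close> by simp
    also have "\<dots> \<le> K ^ l * D"
      using assms \<open>k < l\<close> by (intro mult_right_mono power_increasing) auto
    also have "\<dots> < x l"
      using x \<open>l \<in> {..n}\<close> by simp
    finally show "x k \<noteq> x l" by simp
  qed auto
  then have "card {..n} \<le> card S"
    by (rule card_inj_on_le) (use assms x in auto)
  then show False using assms by simp
qed

definition clustering :: "real \<Rightarrow> real \<Rightarrow> 'i set \<Rightarrow> ('i \<Rightarrow> 'a::metric_space) \<Rightarrow> 'i set set \<Rightarrow> bool" where
  "clustering D L J h P \<longleftrightarrow> partition_on J P
     \<and> (\<forall>c\<in>P. \<forall>i\<in>c. \<forall>j\<in>c. dist (h i) (h j) \<le> D)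
     \<and> (\<forall>c\<in>P. \<forall>d\<in>P. c \<noteq> d \<longrightarrow> (\<forall>i\<in>c. \<forall>j\<in>d. L \<le> dist (h i) (h j)))"

lemma partition_on_part:
  assumes "partition_on J P" "finite J" "c \<in> P"
  shows "finite c" "c \<noteq> {}" "c \<subseteq> J" "card c \<le> card J"
proof -
  show "c \<subseteq> J" using partition_onD1[OF assms(1)] assms(3) by blast
  then show "finite c" "card c \<le> card J"
    using assms(2) by (auto intro: finite_subset card_mono)
  show "c \<noteq> {}" using partition_onD3[OF assms(1)] assms(3) by blast
qed

lemma card_partition_on_le:
  assumes "partition_on J P" "finite J"
  shows "card P \<le> card J"
proof -
  have "(\<Sum>c\<in>P. 1) \<le> (\<Sum>c\<in>P. card c)"
    using partition_on_part[OF assms] by (intro sum_mono) (simp add: Suc_leI card_gt_0_iff)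
  also have "\<dots> = card J"
    by (rule product_partition[OF assms(1) partition_on_part(1)[OF assms], symmetric])
  finally show ?thesis by simp
qed

lemma partition_on_Int:
  assumes "partition_on J P" "I \<subseteq> J"
  shows "partition_on I ((\<inter>) I ` P - {{}})"
  using partition_on_restrict[OF assms(1), of I] assms(2) by (simp add: Int_absorb2)

lemma clustering_Int:
  assumes "clustering D L J h P" "I \<subseteq> J"
  shows "clustering D L I h ((\<inter>) I ` P - {{}})"
  unfolding clustering_def
proof (intro conjI)
  show "partition_on I ((\<inter>) I ` P - {{}})"
    using assms by (auto simp: clustering_def intro: partition_on_Int)
qed (use assms(1) in \<open>unfold clustering_def, blast+\<close>)

lemma clustering_if_gap:
  assumes gap: "\<And>i j. i \<in> J \<Longrightarrow> j \<in> J \<Longrightarrow> dist (h i) (h j) \<le> D \<or> L < dist (h i) (h j)"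
    and "2 * D \<le> L" "D \<ge> 0"
  shows "\<exists>P. clustering D L J h P"
proof -
  define close where "close = {(i, j). i \<in> J \<and> j \<in> J \<and> dist (h i) (h j) \<le> D}"
  have "equiv J close"
  proof (rule equivI)
    show "trans close"
    proof (rule transI)
      fix i j k
      assume "(i, j) \<in> close" "(j, k) \<in> close"
      then show "(i, k) \<in> close"
        using gap[of i k] dist_triangle[of "h i" "h k" "h j"] assms(2) by (auto simp: close_def)
    qed
  qed (use assms(3) in \<open>auto simp: close_def refl_on_def sym_def dist_commute\<close>)
  moreover have "dist (h i) (h j) \<le> D" if "c \<in> J // close" "i \<in> c" "j \<in> c" for c i j
    using quotient_eq_iff[OF \<open>equiv J close\<close> that(1) that(1) that(2,3)] by (simp add: close_def)
  moreover have "L \<le> dist (h i) (h j)"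
    if "c \<in> J // close" "d \<in> J // close" "c \<noteq> d" "i \<in> c" "j \<in> d" for c d i j
  proof -
    have "(i, j) \<notin> close"
      using quotient_eq_iff[OF \<open>equiv J close\<close> that(1,2,4,5)] that(3) by blast
    moreover have "i \<in> J" "j \<in> J"
      using that in_quotient_imp_subset[OF \<open>equiv J close\<close>] by blast+
    ultimately show ?thesis
      using gap[of i j] by (simp add: close_def)
  qed
  ultimately have "clustering D L J h (J // close)"
    by (simp add: clustering_def partition_on_quotient)
  then show ?thesis ..
qed

lemma exists_clustering:
  fixes h :: "'i \<Rightarrow> 'a::metric_space"
  assumes "finite J" "K \<ge> 2" "D \<ge> 0"
  obtains D' P where "D \<le> D'" "D' \<le> K ^ (card J * card J) * D" "clustering D' (K * D') J h P"
proof -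
  define S where "S = (\<lambda>(i, j). dist (h i) (h j)) ` (J \<times> J)"
  have "card S \<le> card J * card J"
    unfolding S_def using assms(1)
    by (metis card_cartesian_product card_image_le finite_cartesian_product)
  then obtain k where k: "k \<le> card J * card J" "\<forall>x\<in>S. x \<le> K ^ k * D \<or> K ^ Suc k * D < x"
    using exists_geometric_gap[of S "card J * card J" K D] assms by (auto simp: S_def)
  define D' where "D' = K ^ k * D"
  have "1 * D \<le> D'" "D' \<le> K ^ (card J * card J) * D"
    unfolding D'_def using assms k(1)
    by (intro mult_right_mono one_le_power power_increasing; simp)+
  moreover have "\<exists>P. clustering D' (K * D') J h P"
  proof (rule clustering_if_gap)
    show "dist (h i) (h j) \<le> D' \<or> K * D' < dist (h i) (h j)" if "i \<in> J" "j \<in> J" for i j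
      using k(2) that by (auto simp: S_def D'_def mult.assoc)
    show "2 * D' \<le> K * D'" "0 \<le> D'"
      using assms by (auto simp: D'_def intro: mult_right_mono)
  qed
  ultimately show ?thesis using that by auto
qed

definition sparse_retractions :: "'i set \<Rightarrow> ('i \<Rightarrow> 'i) set" where
  "sparse_retractions J = {\<rho> \<in> J \<rightarrow>\<^sub>E J. (\<forall>i\<in>J. \<rho> (\<rho> i) = \<rho> i) \<and> 2 * card (\<rho> ` J) < card J}"

lemma finite_sparse_retractions: "finite J \<Longrightarrow> finite (sparse_retractions J)"
  unfolding sparse_retractions_def
  by (rule finite_subset[of _ "J \<rightarrow>\<^sub>E J"]) (auto intro: finite_PiE)

lemma partition_on_sparse_retraction:
  assumes P: "partition_on J P" and "finite J" "2 * card P < card J"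
  obtains \<rho> where "\<rho> \<in> sparse_retractions J" "\<And>i. i \<in> J \<Longrightarrow> \<exists>c\<in>P. i \<in> c \<and> \<rho> i \<in> c"
proof -
  have "\<forall>i\<in>J. \<exists>c. c \<in> P \<and> i \<in> c"
    using partition_onD1[OF P] by blast
  then obtain part where part: "\<And>i. i \<in> J \<Longrightarrow> part i \<in> P \<and> i \<in> part i"
    by metis
  have "\<forall>c\<in>P. \<exists>i. i \<in> c"
    using partition_on_part(2)[OF P \<open>finite J\<close>] by blast
  then obtain rep where rep: "\<And>c. c \<in> P \<Longrightarrow> rep c \<in> c"
    by metis
  note subset = partition_on_part(3)[OF P \<open>finite J\<close>]
  have part_rep: "part (rep c) = c" if "c \<in> P" for c
    using partition_onD2[OF P] part[of "rep c"] rep[OF that] subset that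
    by (meson disjointD disjoint_iff subsetD)
  define \<rho> where "\<rho> = (\<lambda>i\<in>J. rep (part i))"
  have "\<rho> i \<in> J" if "i \<in> J" for i
    using that part rep subset by (fastforce simp: \<rho>_def)
  moreover have "\<rho> (\<rho> i) = \<rho> i" if "i \<in> J" for i
    using that part rep subset part_rep by (fastforce simp: \<rho>_def)
  moreover have "card (\<rho> ` J) \<le> card P"
  proof -
    have "\<rho> ` J \<subseteq> rep ` P"
      using part by (auto simp: \<rho>_def)
    then show ?thesis
      using finite_elements[OF \<open>finite J\<close> P]
      by (meson card_image_le card_mono finite_imageI le_trans)
  qed
  ultimately have "\<rho> \<in> sparse_retractions J"
    using assms(3) by (auto simp: sparse_retractions_def \<rho>_def)
  then show ?thesis
    using that part rep by (fastforce simp: \<rho>_def)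
qed

lemma card_partition_on_less_half:
  assumes P: "partition_on J P" and "finite J"
    and two: "\<And>c. c \<in> P \<Longrightarrow> 2 \<le> card c" and c: "c \<in> P" "3 \<le> card c"
  shows "2 * card P < card J"
proof -
  have "finite P"
    by (rule finite_elements[OF \<open>finite J\<close> P])
  have "card J = (\<Sum>d\<in>P. card d)"
    by (rule product_partition[OF P partition_on_part(1)[OF P \<open>finite J\<close>]])
  also have "\<dots> = card c + (\<Sum>d\<in>P - {c}. card d)"
    using \<open>finite P\<close> c(1) by (rule sum.remove)
  also have "\<dots> \<ge> 3 + (\<Sum>d\<in>P - {c}. 2)"
    using two c(2) by (intro add_mono sum_mono) auto
  finally have "3 + 2 * (card P - 1) \<le> card J"
    using \<open>finite P\<close> c(1) by simp
  then show ?thesis by simp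
qed

lemma partition_on_cases_singleton_pair_sparse:
  assumes P: "partition_on J P" and J: "finite J" "i \<in> J"
  obtains (singleton) k where "{k} \<in> P"
    | (pair) j where "{i, j} \<in> P" "i \<noteq> j"
    | (sparse) "2 * card P < card J"
proof -
  obtain c where c: "c \<in> P" "i \<in> c"
    using partition_onD1[OF P] J(2) by blast
  have "card d \<noteq> 0" if "d \<in> P" for d
    using partition_on_part[OF P J(1) that] by simp
  then consider (one) "\<exists>d\<in>P. card d = 1" | (two) "card c = 2"
    | (three) "\<And>d. d \<in> P \<Longrightarrow> 2 \<le> card d" "3 \<le> card c"
    using c(1) by (metis One_nat_def Suc_1 Suc_leI le_neq_implies_less neq0_conv numeral_3_eq_3)
  then show ?thesis
  proof cases
    case one
    then show ?thesis using singleton by (auto simp: card_1_singleton_iff)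
  next
    case two
    then obtain j where "c = {i, j}" "i \<noteq> j"
      using c(2) by (auto simp: card_2_iff)
    then show ?thesis using pair c(1) by blast
  next
    case three
    then show ?thesis
      using sparse card_partition_on_less_half[OF P J(1) _ c(1)] by blast
  qed
qed

subsection \<open>Factorization of correlations over clusters\<close>

lemma trans_fun_trans_fun:
  assumes "group_action act"
  shows "trans_fun act g (trans_fun act h u) = trans_fun act (g + h) u"
  using assms
  by (auto simp: trans_fun_def group_action_def minus_add simp del: add_uminus_conv_diff)

lemma le_abs_mult_right: "a \<le> C * x \<Longrightarrow> 0 \<le> x \<Longrightarrow> a \<le> \<bar>C\<bar> * x" for a C x :: real
  by (meson abs_ge_self mult_right_mono order_trans)

lemma pairwise_imp_le_Min_dist:
  fixes g :: "nat \<Rightarrow> 'a::metric_space"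
  assumes "2 \<le> q" "pairwise (\<lambda>i j. L \<le> dist (g i) (g j)) {..<q}"
  shows "L \<le> Min {dist (g i) (g j) | i j. i < q \<and> j < q \<and> i \<noteq> j}" (is "L \<le> Min ?S")
proof -
  have "finite ?S"
    by (rule finite_subset[of _ "(\<lambda>(i, j). dist (g i) (g j)) ` ({..<q} \<times> {..<q})"]) auto
  moreover have "dist (g 0) (g 1) \<in> ?S"
    using assms(1) by (intro CollectI exI[of _ 0] exI[of _ 1]) auto
  ultimately show ?thesis
    using assms(2) by (subst Min_ge_iff) (auto simp: pairwise_def)
qed

locale mixing_system = prob_space M for M :: "'x measure" +
  fixes act :: "'h::{metric_space, group_add} \<Rightarrow> 'x \<Rightarrow> 'x"
    and A :: "('x \<Rightarrow> real) set" and N :: "nat \<Rightarrow> ('x \<Rightarrow> real) \<Rightarrow> real"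
  assumes left_inv_metric: "dist (g + x) (g + y) = dist x (y::'h)"
    and action: "group_action act"
    and act_measurable[measurable]: "act h \<in> M \<rightarrow>\<^sub>M M"
    and act_preserving: "distr M M (act h) = M"
    and alg: "inv_subalgebra M act A"
    and seminorms: "adm_seminorms M act A N"
    and mixing: "exp_mixing_all_orders M act A N"
begin

definition correlation :: "'i set \<Rightarrow> ('i \<Rightarrow> 'x \<Rightarrow> real) \<Rightarrow> ('i \<Rightarrow> 'h) \<Rightarrow> real" where
  "correlation I u g = (\<integral>x. (\<Prod>i\<in>I. trans_fun act (g i) (u i) x) \<partial>M)"

lemma A_measurable: "u \<in> A \<Longrightarrow> u \<in> borel_measurable M"
  using alg by (auto simp: inv_subalgebra_def)

lemma A_mult: "u \<in> A \<Longrightarrow> v \<in> A \<Longrightarrow> (\<lambda>x. u x * v x) \<in> A"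
  using alg by (auto simp: inv_subalgebra_def)

lemma A_trans_fun: "u \<in> A \<Longrightarrow> trans_fun act h u \<in> A"
  using alg by (auto simp: inv_subalgebra_def)

lemma A_prod:
  assumes "finite I" "I \<noteq> {}" "\<And>i. i \<in> I \<Longrightarrow> u i \<in> A"
  shows "(\<lambda>x. \<Prod>i\<in>I. u i x) \<in> A"
  using assms by (induction rule: finite_ne_induct) (auto intro: A_mult)

lemma integral_trans_fun:
  assumes "u \<in> borel_measurable M"
  shows "(\<integral>x. trans_fun act h u x \<partial>M) = (\<integral>x. u x \<partial>M)"
proof -
  have "(\<integral>x. u x \<partial>M) = (\<integral>x. u x \<partial>distr M M (act (- h)))"
    by (simp add: act_preserving)
  also have "\<dots> = (\<integral>x. u (act (- h) x) \<partial>M)"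
    using assms by (intro integral_distr) auto
  finally show ?thesis
    by (simp add: trans_fun_def)
qed

lemma N_nonneg: "1 \<le> s \<Longrightarrow> u \<in> A \<Longrightarrow> 0 \<le> N s u"
  using seminorms unfolding adm_seminorms_def by blast

lemma N_Suc_bound:
  assumes "1 \<le> s"
  obtains C where "C \<ge> 0" "\<And>u. u \<in> A \<Longrightarrow> N s u \<le> C * N (Suc s) u"
proof -
  obtain C where "\<forall>u\<in>A. N s u \<le> C * N (s + 1) u"
    using seminorms assms unfolding adm_seminorms_def by blast
  then have "N s u \<le> \<bar>C\<bar> * N (Suc s) u" if "u \<in> A" for u
    using that assms by (intro le_abs_mult_right N_nonneg) auto
  then show ?thesis by (intro that[of "\<bar>C\<bar>"]) auto
qed

lemma N_mono_bound:
  assumes "1 \<le> s" "s \<le> t"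
  shows "\<exists>C\<ge>0. \<forall>u\<in>A. N s u \<le> C * N t u"
  using assms(2)
proof (induction t rule: dec_induct)
  case base
  show ?case by (intro exI[of _ 1]) auto
next
  case (step t)
  obtain C where C: "C \<ge> 0" "\<forall>u\<in>A. N s u \<le> C * N t u"
    using step by blast
  obtain C' where C': "C' \<ge> 0" "\<And>u. u \<in> A \<Longrightarrow> N t u \<le> C' * N (Suc t) u"
    using N_Suc_bound[of t] assms step by auto
  have "N s u \<le> C * C' * N (Suc t) u" if "u \<in> A" for u
  proof -
    have "N s u \<le> C * N t u" using C that by blast
    also have "\<dots> \<le> C * (C' * N (Suc t) u)"
      using C C' that by (intro mult_left_mono) auto
    finally show ?thesis by simp
  qed
  then show ?case
    using C C' by (intro exI[of _ "C * C'"]) auto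
qed

lemma N_mult_bound:
  assumes "1 \<le> s" "Suc s \<le> t"
  obtains C where "C \<ge> 0"
    "\<And>u v. u \<in> A \<Longrightarrow> v \<in> A \<Longrightarrow> N s (\<lambda>x. u x * v x) \<le> C * (N t u * N (Suc s) v)"
proof -
  obtain C where C: "\<forall>u\<in>A. \<forall>v\<in>A. N s (\<lambda>x. u x * v x) \<le> C * N (s + 1) u * N (s + 1) v"
    using seminorms assms unfolding adm_seminorms_def by blast
  obtain C' where C': "C' \<ge> 0" "\<And>u. u \<in> A \<Longrightarrow> N (Suc s) u \<le> C' * N t u"
    using N_mono_bound[of "Suc s" t] assms by auto
  have "N s (\<lambda>x. u x * v x) \<le> \<bar>C\<bar> * C' * (N t u * N (Suc s) v)" if "u \<in> A" "v \<in> A" for u v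
  proof -
    have "N s (\<lambda>x. u x * v x) \<le> \<bar>C\<bar> * (N (Suc s) u * N (Suc s) v)"
      using C that assms
      by (intro le_abs_mult_right mult_nonneg_nonneg N_nonneg) (auto simp: mult.assoc)
    also have "\<dots> \<le> \<bar>C\<bar> * ((C' * N t u) * N (Suc s) v)"
      using C' that by (intro mult_left_mono mult_right_mono N_nonneg) auto
    finally show ?thesis by (simp add: mult.assoc)
  qed
  then show ?thesis using C'(1) by (intro that[of "\<bar>C\<bar> * C'"]) auto
qed

lemma N_prod_insert_bound:
  assumes "1 \<le> s" "Suc s \<le> t" "C \<ge> 0"
  obtains C' where "C' \<ge> 0"
    "\<And>(a :: 'i) J u. finite J \<Longrightarrow> a \<notin> J \<Longrightarrow> (\<And>i. i \<in> insert a J \<Longrightarrow> u i \<in> A) \<Longrightarrow>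
      (J \<noteq> {} \<Longrightarrow> N (Suc s) (\<lambda>x. \<Prod>i\<in>J. u i x) \<le> C * (\<Prod>i\<in>J. N t (u i))) \<Longrightarrow>
      N s (\<lambda>x. \<Prod>i\<in>insert a J. u i x) \<le> C' * (\<Prod>i\<in>insert a J. N t (u i))"
proof -
  obtain C1 where C1: "C1 \<ge> 0" "\<And>u. u \<in> A \<Longrightarrow> N s u \<le> C1 * N t u"
    using N_mono_bound[of s t] assms by auto
  obtain C2 where C2: "C2 \<ge> 0"
    "\<And>u v. u \<in> A \<Longrightarrow> v \<in> A \<Longrightarrow> N s (\<lambda>x. u x * v x) \<le> C2 * (N t u * N (Suc s) v)"
    by (rule N_mult_bound[OF assms(1,2)]) blast
  have "N s (\<lambda>x. \<Prod>i\<in>insert a J. u i x) \<le> max C1 (C2 * C) * (\<Prod>i\<in>insert a J. N t (u i))"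
    if J: "finite J" "a \<notin> J" and u: "\<And>i. i \<in> insert a J \<Longrightarrow> u i \<in> A"
      and IH: "J \<noteq> {} \<Longrightarrow> N (Suc s) (\<lambda>x. \<Prod>i\<in>J. u i x) \<le> C * (\<Prod>i\<in>J. N t (u i))"
    for a :: 'i and J u
  proof -
    have "\<exists>c\<in>{C1, C2 * C}. N s (\<lambda>x. \<Prod>i\<in>insert a J. u i x) \<le> c * (\<Prod>i\<in>insert a J. N t (u i))"
    proof (cases "J = {}")
      case True
      then show ?thesis using C1(2)[of "u a"] u by simp
    next
      case False
      have "N s (\<lambda>x. \<Prod>i\<in>insert a J. u i x) \<le> C2 * (N t (u a) * N (Suc s) (\<lambda>x. \<Prod>i\<in>J. u i x))"
        using C2(2)[of "u a" "\<lambda>x. \<Prod>i\<in>J. u i x"] u J False by (simp add: A_prod)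
      also have "\<dots> \<le> C2 * (N t (u a) * (C * (\<Prod>i\<in>J. N t (u i))))"
        using u assms C2(1) by (intro mult_left_mono IH[OF False] N_nonneg) auto
      also have "\<dots> = C2 * C * (\<Prod>i\<in>insert a J. N t (u i))"
        using J by simp
      finally show ?thesis by blast
    qed
    moreover have "0 \<le> (\<Prod>i\<in>insert a J. N t (u i))"
      using u assms by (intro prod_nonneg N_nonneg ballI) auto
    ultimately show ?thesis
      by (elim bexE) (erule order_trans, auto intro: mult_right_mono)
  qed
  then show ?thesis
    using C1(1) by (intro that[of "max C1 (C2 * C)"]) auto
qed

lemma N_prod_bound:
  assumes "1 \<le> s"
  shows "\<exists>C\<ge>0. \<forall>(I :: 'i set) u. finite I \<and> I \<noteq> {} \<and> card I \<le> Suc n \<and> (\<forall>i\<in>I. u i \<in> A) \<longrightarrow>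
    N s (\<lambda>x. \<Prod>i\<in>I. u i x) \<le> C * (\<Prod>i\<in>I. N (s + n) (u i))"
  using assms
proof (induction n arbitrary: s)
  case 0
  have "N s (\<lambda>x. \<Prod>i\<in>I. u i x) \<le> 1 * (\<Prod>i\<in>I. N (s + 0) (u i))"
    if "finite I" "I \<noteq> {}" "card I \<le> Suc 0" for I :: "'i set" and u
    using that by (auto simp: le_Suc_eq card_Suc_eq)
  then show ?case by (intro exI[of _ 1]) auto
next
  case (Suc n)
  define t where "t = s + Suc n"
  have "Suc s \<le> t" by (simp add: t_def)
  obtain C where C: "C \<ge> 0"
    "\<And>(I :: 'i set) u. finite I \<Longrightarrow> I \<noteq> {} \<Longrightarrow> card I \<le> Suc n \<Longrightarrow> (\<And>i. i \<in> I \<Longrightarrow> u i \<in> A) \<Longrightarrow>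
      N (Suc s) (\<lambda>x. \<Prod>i\<in>I. u i x) \<le> C * (\<Prod>i\<in>I. N t (u i))"
    using Suc.IH[of "Suc s"] unfolding t_def by (metis add_Suc_shift le_SucI Suc.prems)
  obtain C' where C': "C' \<ge> 0"
    "\<And>(a :: 'i) J u. finite J \<Longrightarrow> a \<notin> J \<Longrightarrow> (\<And>i. i \<in> insert a J \<Longrightarrow> u i \<in> A) \<Longrightarrow>
      (J \<noteq> {} \<Longrightarrow> N (Suc s) (\<lambda>x. \<Prod>i\<in>J. u i x) \<le> C * (\<Prod>i\<in>J. N t (u i))) \<Longrightarrow>
      N s (\<lambda>x. \<Prod>i\<in>insert a J. u i x) \<le> C' * (\<Prod>i\<in>insert a J. N t (u i))"
    by (rule N_prod_insert_bound[OF Suc.prems \<open>Suc s \<le> t\<close> C(1)]) blast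
  have "N s (\<lambda>x. \<Prod>i\<in>I. u i x) \<le> C' * (\<Prod>i\<in>I. N t (u i))"
    if I: "finite I" "I \<noteq> {}" "card I \<le> Suc (Suc n)" "\<And>i. i \<in> I \<Longrightarrow> u i \<in> A" for I :: "'i set" and u
  proof -
    obtain a J where J: "I = insert a J" "a \<notin> J" "finite J" "card J \<le> Suc n"
      using I
      by (metis all_not_in_conv card_insert_disjoint finite_insert mk_disjoint_insert Suc_le_mono)
    then show ?thesis
      using I(4) C'(2)[OF J(3,2)] C(2)[OF J(3) _ J(4)] by blast
  qed
  then show ?case
    unfolding t_def[symmetric] using C'(1) by blast
qed

lemma dist_recentre: "dist (- g + h) 0 = dist h g" for g h :: 'h
  using left_inv_metric[of g "- g + h" 0] by (simp add: add.assoc[symmetric])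

lemma clustering_representatives:
  fixes h :: "'i \<Rightarrow> 'h"
  assumes "clustering D L J h P"
  obtains g where "pairwise (\<lambda>c d. L \<le> dist (g c) (g d)) P"
    and "\<And>c i. c \<in> P \<Longrightarrow> i \<in> c \<Longrightarrow> dist (- g c + h i) 0 \<le> D"
proof -
  have "{} \<notin> P"
    using assms by (auto simp: clustering_def dest: partition_onD3)
  then have "\<forall>c\<in>P. \<exists>i. i \<in> c"
    by (metis all_not_in_conv)
  then obtain rep where "\<And>c. c \<in> P \<Longrightarrow> rep c \<in> c"
    by metis
  then show ?thesis
    using assms
    by (intro that[of "\<lambda>c. h (rep c)"]) (auto simp: clustering_def pairwise_def dist_recentre)
qed

lemma trans_fun_prod_recentre:
  "trans_fun act g (\<lambda>x. \<Prod>i\<in>c. trans_fun act (- g + h i) (u i) x) x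
    = (\<Prod>i\<in>c. trans_fun act (h i) (u i) x)"
proof -
  have "trans_fun act g (\<lambda>x. \<Prod>i\<in>c. trans_fun act (- g + h i) (u i) x) x
      = (\<Prod>i\<in>c. trans_fun act g (trans_fun act (- g + h i) (u i)) x)"
    by (simp add: trans_fun_def)
  then show ?thesis
    by (simp add: trans_fun_trans_fun[OF action] add.assoc[symmetric])
qed

lemma expectation_prod_recentre:
  assumes "\<And>i. i \<in> c \<Longrightarrow> u i \<in> A"
  shows "expectation (\<lambda>x. \<Prod>i\<in>c. trans_fun act (- g + h i) (u i) x) = correlation c u h"
proof -
  have "(\<lambda>x. \<Prod>i\<in>c. trans_fun act (- g + h i) (u i) x) \<in> borel_measurable M"
    using assms by (intro borel_measurable_prod A_measurable A_trans_fun)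
  from integral_trans_fun[OF this, of g] show ?thesis
    by (simp add: trans_fun_prod_recentre correlation_def)
qed

lemma correlation_partition:
  assumes "finite J" "partition_on J P"
  shows "correlation P (\<lambda>c x. \<Prod>i\<in>c. trans_fun act (- g c + h i) (u i) x) g = correlation J u h"
proof -
  have "(\<Prod>c\<in>P. \<Prod>i\<in>c. trans_fun act (h i) (u i) x) = (\<Prod>i\<in>J. trans_fun act (h i) (u i) x)" for x
    by (rule prod.partition[OF assms, symmetric])
  then show ?thesis
    by (simp add: correlation_def trans_fun_prod_recentre)
qed

definition mixing_defect :: "'i set \<Rightarrow> ('i \<Rightarrow> 'x \<Rightarrow> real) \<Rightarrow> ('i \<Rightarrow> 'h) \<Rightarrow> real" where
  "mixing_defect I u g = \<bar>correlation I u g - (\<Prod>i\<in>I. expectation (u i))\<bar>"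

definition mixing_rate :: "nat \<Rightarrow> real \<Rightarrow> nat \<Rightarrow> real \<Rightarrow> bool" where
  "mixing_rate q \<delta> s C \<longleftrightarrow> (\<forall>u g. \<forall>L\<ge>0. (\<forall>i<q. u i \<in> A) \<longrightarrow>
     pairwise (\<lambda>i j. L \<le> dist (g i) (g j)) {..<q} \<longrightarrow>
     mixing_defect {..<q} u g \<le> C * exp (- \<delta> * L) * (\<Prod>i<q. N s (u i)))"

lemma mixing_rateD:
  assumes "mixing_rate q \<delta> s C" "L \<ge> 0" "\<And>i. i < q \<Longrightarrow> u i \<in> A"
    and "pairwise (\<lambda>i j. L \<le> dist (g i) (g j)) {..<q}"
  shows "mixing_defect {..<q} u g \<le> C * exp (- \<delta> * L) * (\<Prod>i<q. N s (u i))"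
  using assms unfolding mixing_rate_def by simp

lemma mixing_rate_mono:
  assumes rate: "mixing_rate q \<delta> s C" and "\<delta>' \<le> \<delta>" "C \<le> C'" "0 \<le> C'" "1 \<le> s"
  shows "mixing_rate q \<delta>' s C'"
  unfolding mixing_rate_def
proof (intro allI impI)
  fix u and g :: "nat \<Rightarrow> 'h" and L :: real
  assume L: "0 \<le> L" and u: "\<forall>i<q. u i \<in> A"
    and "pairwise (\<lambda>i j. L \<le> dist (g i) (g j)) {..<q}"
  then have "mixing_defect {..<q} u g \<le> C * exp (- \<delta> * L) * (\<Prod>i<q. N s (u i))"
    by (intro mixing_rateD[OF rate]) auto
  also have "\<dots> \<le> C' * exp (- \<delta>' * L) * (\<Prod>i<q. N s (u i))"
    using assms L u by (intro mult_right_mono mult_mono prod_nonneg ballI N_nonneg)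
      (auto simp: mult_right_mono)
  finally show "mixing_defect {..<q} u g \<le> C' * exp (- \<delta>' * L) * (\<Prod>i<q. N s (u i))" .
qed

lemma exists_mixing_rate_ge_2:
  assumes "2 \<le> q"
  shows "\<exists>\<delta>>0. \<exists>s0. \<forall>s>s0. \<exists>C. mixing_rate q \<delta> s C"
proof -
  let ?separation = "\<lambda>g :: nat \<Rightarrow> 'h. Min {dist (g i) (g j) | i j. i < q \<and> j < q \<and> i \<noteq> j}"
  obtain \<delta> s0 where "\<delta> > 0" and mix: "\<And>s. s > s0 \<Longrightarrow> \<exists>C. \<forall>u g. (\<forall>i<q. u i \<in> A) \<longrightarrow>
      mixing_defect {..<q} u g \<le> C * exp (- \<delta> * ?separation g) * (\<Prod>i<q. N s (u i))"
    using mixing assms unfolding exp_mixing_all_orders_def mixing_defect_def correlation_def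
    by meson
  have "\<exists>C. mixing_rate q \<delta> s C" if "s > s0" for s
  proof -
    obtain C where C: "\<forall>u g. (\<forall>i<q. u i \<in> A) \<longrightarrow>
        mixing_defect {..<q} u g \<le> C * exp (- \<delta> * ?separation g) * (\<Prod>i<q. N s (u i))"
      using mix[OF \<open>s > s0\<close>] by blast
    have "mixing_defect {..<q} u g \<le> \<bar>C\<bar> * exp (- \<delta> * L) * (\<Prod>i<q. N s (u i))"
      if u: "\<forall>i<q. u i \<in> A" and g: "pairwise (\<lambda>i j. L \<le> dist (g i) (g j)) {..<q}" for u g L
    proof -
      have nonneg: "0 \<le> (\<Prod>i<q. N s (u i))"
        using \<open>s > s0\<close> u by (intro prod_nonneg ballI N_nonneg) auto
      have "mixing_defect {..<q} u g \<le> \<bar>C\<bar> * (exp (- \<delta> * ?separation g) * (\<Prod>i<q. N s (u i)))"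
        using C u
        by (intro le_abs_mult_right mult_nonneg_nonneg nonneg) (simp_all add: mult.assoc[symmetric])
      also have "\<dots> \<le> \<bar>C\<bar> * (exp (- \<delta> * L) * (\<Prod>i<q. N s (u i)))"
        using pairwise_imp_le_Min_dist[OF assms g] \<open>\<delta> > 0\<close> nonneg
        by (intro mult_left_mono mult_right_mono) auto
      finally show ?thesis by (simp add: mult.assoc)
    qed
    then show ?thesis
      unfolding mixing_rate_def by blast
  qed
  with \<open>\<delta> > 0\<close> show ?thesis by blast
qed

lemma mixing_rate_less_2:
  assumes "q < 2"
  shows "mixing_rate q \<delta> s 0"
proof -
  have "correlation {..<q} u g = (\<Prod>i<q. expectation (u i))" if "\<forall>i<q. u i \<in> A" for u g
  proof -
    consider "q = 0" | "q = 1" using assms by linarith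
    then show ?thesis
      using that integral_trans_fun[OF A_measurable, of "u 0"]
      by cases (simp_all add: correlation_def prob_space lessThan_Suc)
  qed
  then show ?thesis
    by (simp add: mixing_rate_def mixing_defect_def)
qed

lemma exists_mixing_rate: "\<exists>\<delta>>0. \<exists>s0. \<forall>s>s0. \<exists>C. mixing_rate q \<delta> s C"
  using exists_mixing_rate_ge_2[of q] mixing_rate_less_2[of q 1] by (metis not_le zero_less_one)

lemma uniform_mixing_rate:
  obtains \<delta> s C where "\<delta> > 0" "1 \<le> s" "C \<ge> 0" "\<And>q. q \<le> r \<Longrightarrow> mixing_rate q \<delta> s C"
proof -
  obtain \<delta> s0 where \<delta>: "\<And>q. \<delta> q > 0" and rate: "\<And>q s. s > s0 q \<Longrightarrow> \<exists>C. mixing_rate q (\<delta> q) s C"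
    using exists_mixing_rate by metis
  define s where "s = Suc (Max (s0 ` {..r}))"
  have "s > s0 q" if "q \<le> r" for q
    using that by (simp add: s_def less_Suc_eq_le)
  then have "\<forall>q. \<exists>C. q \<le> r \<longrightarrow> mixing_rate q (\<delta> q) s C"
    using rate by blast
  then obtain C where C: "\<And>q. q \<le> r \<Longrightarrow> mixing_rate q (\<delta> q) s (C q)"
    by metis
  define \<delta>' where "\<delta>' = Min (\<delta> ` {..r})"
  define C' where "C' = Max (insert 0 (C ` {..r}))"
  have "\<delta>' > 0" using \<delta> by (simp add: \<delta>'_def)
  moreover have "1 \<le> s" by (simp add: s_def)
  moreover have "C' \<ge> 0" by (simp add: C'_def)
  moreover have "mixing_rate q \<delta>' s C'" if "q \<le> r" for q
    using that \<open>1 \<le> s\<close>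
    by (intro mixing_rate_mono[OF C[OF that]]) (auto simp: \<delta>'_def C'_def le_max_iff_disj)
  ultimately show ?thesis by (rule that)
qed

lemma mixing_defect_decay:
  obtains \<delta> s C where "\<delta> > 0" "1 \<le> s" "C \<ge> 0"
    and "\<And>(I :: 'i set) u g L. finite I \<Longrightarrow> card I \<le> r \<Longrightarrow> 0 \<le> L \<Longrightarrow> (\<And>i. i \<in> I \<Longrightarrow> u i \<in> A) \<Longrightarrow>
      pairwise (\<lambda>i j. L \<le> dist (g i) (g j)) I \<Longrightarrow>
      mixing_defect I u g \<le> C * exp (- \<delta> * L) * (\<Prod>i\<in>I. N s (u i))"
proof -
  obtain \<delta> s C where pos: "\<delta> > 0" "1 \<le> s" "C \<ge> 0"
    and rate: "\<And>q. q \<le> r \<Longrightarrow> mixing_rate q \<delta> s C"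
    by (rule uniform_mixing_rate[of r]) blast
  have "mixing_defect I u g \<le> C * exp (- \<delta> * L) * (\<Prod>i\<in>I. N s (u i))"
    if I: "finite I" "card I \<le> r" and L: "0 \<le> L" and u: "\<And>i. i \<in> I \<Longrightarrow> u i \<in> A"
      and g: "pairwise (\<lambda>i j. L \<le> dist (g i) (g j)) I" for I :: "'i set" and u g L
  proof -
    obtain e where e: "bij_betw e {..<card I} I"
      using ex_bij_betw_nat_finite[OF I(1)] by (auto simp: atLeast0LessThan)
    have reindex: "(\<Prod>k<card I. w (e k)) = (\<Prod>i\<in>I. w i)" for w :: "'i \<Rightarrow> real"
      by (rule prod.reindex_bij_betw[OF e])
    have "u (e k) \<in> A" if "k < card I" for k
      using u e that by (auto simp: bij_betw_def)
    moreover have "pairwise (\<lambda>k l. L \<le> dist (g (e k)) (g (e l))) {..<card I}"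
      using g e unfolding pairwise_def bij_betw_def inj_on_def by blast
    ultimately have "mixing_defect {..<card I} (\<lambda>k. u (e k)) (\<lambda>k. g (e k))
        \<le> C * exp (- \<delta> * L) * (\<Prod>k<card I. N s (u (e k)))"
      by (intro mixing_rateD[OF rate[OF I(2)] L])
    then show ?thesis
      using reindex[of "\<lambda>i. trans_fun act (g i) (u i) _"] reindex[of "\<lambda>i. expectation (u i)"]
        reindex[of "\<lambda>i. N s (u i)"] by (simp add: mixing_defect_def correlation_def)
  qed
  with pos show ?thesis by (rule that)
qed

end

locale mixing_observable = mixing_system M act A N
  for M :: "'x measure" and act :: "'h::{metric_space, group_add} \<Rightarrow> 'x \<Rightarrow> 'x"
    and A :: "('x \<Rightarrow> real) set" and N :: "nat \<Rightarrow> ('x \<Rightarrow> real) \<Rightarrow> real" +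
  fixes f :: "'x \<Rightarrow> real"
  assumes fA: "f \<in> A" and mean0: "expectation f = 0"
begin

lemma f_measurable[measurable]: "f \<in> borel_measurable M"
  by (rule A_measurable[OF fA])

definition corr :: "'i set \<Rightarrow> ('i \<Rightarrow> 'h) \<Rightarrow> real" where
  "corr J h = correlation J (\<lambda>_. f) h"

lemma corr_empty: "corr {} h = 1"
  by (simp add: corr_def correlation_def prob_space)

lemma corr_singleton: "corr {i} h = 0"
  by (simp add: corr_def correlation_def integral_trans_fun mean0)

lemma N_trans_fun_bound:
  assumes "1 \<le> s"
  obtains \<sigma> C where "\<sigma> > 0" "C \<ge> 1"
    "\<And>h D. dist h 0 \<le> D \<Longrightarrow> N s (trans_fun act h f) \<le> C * exp (\<sigma> * D)"
proof -
  obtain \<sigma> C where \<sigma>: "\<sigma> > 0"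
    and C: "\<forall>u\<in>A. \<forall>h. N s (trans_fun act h u) \<le> C * exp (\<sigma> * dist h 0) * N s u"
    using seminorms assms unfolding adm_seminorms_def by meson
  have "N s (trans_fun act h f) \<le> max 1 (C * N s f) * exp (\<sigma> * D)" if "dist h 0 \<le> D" for h D
  proof -
    have "N s (trans_fun act h f) \<le> C * N s f * exp (\<sigma> * dist h 0)"
      using C fA by (simp add: mult_ac)
    also have "\<dots> \<le> max 1 (C * N s f) * exp (\<sigma> * D)"
      using that \<sigma> by (intro mult_mono) auto
    finally show ?thesis .
  qed
  with \<sigma> show ?thesis by (intro that[of \<sigma> "max 1 (C * N s f)"]) auto
qed

lemma N_prod_trans_fun_bound:
  assumes "1 \<le> s"
  obtains C \<tau> where "C \<ge> 1" "\<tau> \<ge> 0"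
    "\<And>(I :: 'i set) g D. finite I \<Longrightarrow> I \<noteq> {} \<Longrightarrow> card I \<le> r \<Longrightarrow> (\<And>i. i \<in> I \<Longrightarrow> dist (g i) 0 \<le> D) \<Longrightarrow>
      N s (\<lambda>x. \<Prod>i\<in>I. trans_fun act (g i) f x) \<le> C * exp (\<tau> * D)"
proof -
  obtain C1 where C1: "C1 \<ge> 0"
    "\<And>(I :: 'i set) u. finite I \<Longrightarrow> I \<noteq> {} \<Longrightarrow> card I \<le> Suc r \<Longrightarrow> (\<And>i. i \<in> I \<Longrightarrow> u i \<in> A) \<Longrightarrow>
      N s (\<lambda>x. \<Prod>i\<in>I. u i x) \<le> C1 * (\<Prod>i\<in>I. N (s + r) (u i))"
    using N_prod_bound[OF assms, of r] by metis
  obtain \<sigma> C2 where \<sigma>: "\<sigma> > 0" and C2: "C2 \<ge> 1"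
    "\<And>h D. dist h 0 \<le> D \<Longrightarrow> N (s + r) (trans_fun act h f) \<le> C2 * exp (\<sigma> * D)"
    using N_trans_fun_bound[of "s + r"] assms by (metis trans_le_add1)
  have "N s (\<lambda>x. \<Prod>i\<in>I. trans_fun act (g i) f x) \<le> max 1 (C1 * C2 ^ r) * exp (\<sigma> * r * D)"
    if I: "finite I" "I \<noteq> {}" "card I \<le> r" "\<And>i. i \<in> I \<Longrightarrow> dist (g i) 0 \<le> D"
    for I :: "'i set" and g D
  proof -
    have "D \<ge> 0"
      using I by (metis all_not_in_conv order_trans zero_le_dist)
    then have ge1: "1 * 1 \<le> C2 * exp (\<sigma> * D)"
      using \<sigma> C2(1) by (intro mult_mono) auto
    have "N s (\<lambda>x. \<Prod>i\<in>I. trans_fun act (g i) f x) \<le> C1 * (\<Prod>i\<in>I. N (s + r) (trans_fun act (g i) f))"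
      using I by (intro C1(2) A_trans_fun fA) auto
    also have "\<dots> \<le> C1 * (\<Prod>i\<in>I. C2 * exp (\<sigma> * D))"
      using I assms by (intro mult_left_mono prod_mono conjI C1(1) C2 N_nonneg A_trans_fun fA) auto
    also have "\<dots> \<le> C1 * (C2 * exp (\<sigma> * D)) ^ r"
      using I ge1 C1(1) by (simp add: mult_left_mono power_increasing)
    also have "\<dots> = C1 * C2 ^ r * exp (\<sigma> * r * D)"
      by (simp add: power_mult_distrib exp_of_nat_mult[symmetric] mult_ac)
    also have "\<dots> \<le> max 1 (C1 * C2 ^ r) * exp (\<sigma> * r * D)"
      by (intro mult_right_mono) auto
    finally show ?thesis .
  qed
  then show ?thesis
    using \<sigma> by (intro that[of "max 1 (C1 * C2 ^ r)" "\<sigma> * r"]) auto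
qed

lemma clustering_recentred_products:
  fixes J :: "'i set"
  assumes "finite J" "clustering D L J h P" "1 \<le> s" "E \<ge> 1"
    and N_le: "\<And>(c :: 'i set) g. finite c \<Longrightarrow> c \<noteq> {} \<Longrightarrow> card c \<le> card J \<Longrightarrow>
      (\<And>i. i \<in> c \<Longrightarrow> dist (g i) 0 \<le> D) \<Longrightarrow>
      N s (\<lambda>x. \<Prod>i\<in>c. trans_fun act (g i) f x) \<le> E"
  obtains u g where "\<And>c. c \<in> P \<Longrightarrow> u c \<in> A" "pairwise (\<lambda>c d. L \<le> dist (g c) (g d)) P"
    "(\<Prod>c\<in>P. N s (u c)) \<le> E ^ card J" "mixing_defect P u g = \<bar>corr J h - (\<Prod>c\<in>P. corr c h)\<bar>"
proof -
  have part: "partition_on J P" using assms(2) by (simp add: clustering_def)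
  note cluster = partition_on_part[OF part assms(1)]
  obtain g where g: "pairwise (\<lambda>c d. L \<le> dist (g c) (g d)) P"
    "\<And>c i. c \<in> P \<Longrightarrow> i \<in> c \<Longrightarrow> dist (- g c + h i) 0 \<le> D"
    using clustering_representatives[OF assms(2)] by blast
  define u where "u = (\<lambda>c x. \<Prod>i\<in>c. trans_fun act (- g c + h i) f x)"
  have uA: "u c \<in> A" if "c \<in> P" for c
    unfolding u_def using cluster[OF that] by (intro A_prod A_trans_fun fA)
  have "N s (u c) \<le> E" if "c \<in> P" for c
    unfolding u_def using cluster[OF that] g(2)[OF that] by (intro N_le)
  then have "(\<Prod>c\<in>P. N s (u c)) \<le> (\<Prod>c\<in>P. E)"
    using uA assms(3) by (intro prod_mono conjI N_nonneg)
  also have "\<dots> \<le> E ^ card J"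
    using card_partition_on_le[OF part assms(1)] assms(4) by (simp add: power_increasing)
  finally have "(\<Prod>c\<in>P. N s (u c)) \<le> E ^ card J" .
  moreover have "mixing_defect P u g = \<bar>corr J h - (\<Prod>c\<in>P. corr c h)\<bar>"
    by (simp add: u_def mixing_defect_def corr_def correlation_partition[OF assms(1) part]
        expectation_prod_recentre[OF fA])
  ultimately show ?thesis
    using uA g(1) by (rule that[rotated 2])
qed

lemma corr_factorization:
  obtains C K where "C \<ge> 0" "K \<ge> 2"
    "\<And>(J :: 'i set) h D P. finite J \<Longrightarrow> card J \<le> r \<Longrightarrow> D \<ge> 0 \<Longrightarrow> clustering D (K * D) J h P \<Longrightarrow>
      \<bar>corr J h - (\<Prod>c\<in>P. corr c h)\<bar> \<le> C * exp (- D)"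
proof -
  obtain \<delta> s C1 where \<delta>: "\<delta> > 0" and "1 \<le> s" and C1: "C1 \<ge> 0"
    and decay: "\<And>(P :: 'i set set) u g L. finite P \<Longrightarrow> card P \<le> r \<Longrightarrow> 0 \<le> L \<Longrightarrow>
      (\<And>c. c \<in> P \<Longrightarrow> u c \<in> A) \<Longrightarrow> pairwise (\<lambda>c d. L \<le> dist (g c) (g d)) P \<Longrightarrow>
      mixing_defect P u g \<le> C1 * exp (- \<delta> * L) * (\<Prod>c\<in>P. N s (u c))"
    by (rule mixing_defect_decay[of r]) blast
  obtain C2 \<tau> where C2: "C2 \<ge> 1" and \<tau>: "\<tau> \<ge> 0" and N_le:
    "\<And>(I :: 'i set) g D. finite I \<Longrightarrow> I \<noteq> {} \<Longrightarrow> card I \<le> r \<Longrightarrow> (\<And>i. i \<in> I \<Longrightarrow> dist (g i) 0 \<le> D) \<Longrightarrow>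
      N s (\<lambda>x. \<Prod>i\<in>I. trans_fun act (g i) f x) \<le> C2 * exp (\<tau> * D)"
    by (rule N_prod_trans_fun_bound[OF \<open>1 \<le> s\<close>, of r]) blast
  \<comment> \<open>For this K the mixing rate at separation K D beats the growth of at most r cluster seminorms.\<close>
  define K where "K = max 2 ((\<tau> * r + 1) / \<delta>)"
  have K: "K \<ge> 2" "\<delta> * K \<ge> \<tau> * r + 1"
    using \<delta> by (auto simp: K_def max_def field_simps)
  have "\<bar>corr J h - (\<Prod>c\<in>P. corr c h)\<bar> \<le> C1 * C2 ^ r * exp (- D)"
    if J: "finite J" "card J \<le> r" and D: "D \<ge> 0" and P: "clustering D (K * D) J h P"
    for J :: "'i set" and h D P
  proof -
    have part: "partition_on J P" using P by (simp add: clustering_def)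
    have E: "C2 * exp (\<tau> * D) \<ge> 1"
      using mult_mono[OF C2, of 1 "exp (\<tau> * D)"] C2 \<tau> D by simp
    obtain u g where u: "\<And>c. c \<in> P \<Longrightarrow> u c \<in> A" "(\<Prod>c\<in>P. N s (u c)) \<le> (C2 * exp (\<tau> * D)) ^ card J"
      and g: "pairwise (\<lambda>c d. K * D \<le> dist (g c) (g d)) P"
      and defect: "mixing_defect P u g = \<bar>corr J h - (\<Prod>c\<in>P. corr c h)\<bar>"
      by (rule clustering_recentred_products[OF J(1) P \<open>1 \<le> s\<close> E]) (use N_le J(2) in auto)
    have "mixing_defect P u g \<le> C1 * exp (- \<delta> * (K * D)) * (\<Prod>c\<in>P. N s (u c))"
      using finite_elements[OF J(1) part] card_partition_on_le[OF part J(1)] J(2) D K(1)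
      by (intro decay u(1) g) auto
    also have "\<dots> \<le> C1 * exp (- \<delta> * (K * D)) * (C2 * exp (\<tau> * D)) ^ r"
      using u(2) power_increasing[OF J(2) E] C1 by (intro mult_left_mono) auto
    also have "\<dots> = C1 * C2 ^ r * exp (\<tau> * r * D - \<delta> * K * D)"
      by (simp add: power_mult_distrib exp_of_nat_mult[symmetric] exp_diff exp_minus field_simps)
    also have "\<dots> \<le> C1 * C2 ^ r * exp (- D)"
      using mult_right_mono[OF K(2) D] C1 C2 by (intro mult_left_mono) (auto simp: algebra_simps)
    finally show ?thesis by (simp add: defect)
  qed
  then show ?thesis
    using C1 C2 K(1) by (intro that[of "C1 * C2 ^ r" K]) auto
qed

end

subsection \<open>Recursion for correlations\<close>

text \<open>In the application, \<open>\<rho>\<close> maps an index to the representative of its cluster.\<close>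

definition tethered :: "real \<Rightarrow> 'i set \<Rightarrow> ('i \<Rightarrow> 'i) \<Rightarrow> ('i \<Rightarrow> 'a::metric_space) set" where
  "tethered R J \<rho> = {h. \<forall>i\<in>J. dist (h i) (h (\<rho> i)) \<le> R}"

definition tethered_count :: "real \<Rightarrow> 'i set \<Rightarrow> ('i \<Rightarrow> 'a::metric_space) \<Rightarrow> real" where
  "tethered_count R J h = (\<Sum>\<rho>\<in>sparse_retractions J. indicat_real (tethered R J \<rho>) h)"

lemma tethered_count_nonneg: "0 \<le> tethered_count R J h"
  by (simp add: tethered_count_def sum_nonneg)

lemma one_le_tethered_count:
  assumes "finite J" "\<rho> \<in> sparse_retractions J" "h \<in> tethered R J \<rho>"
  shows "1 \<le> tethered_count R J h"
  unfolding tethered_count_def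
  using member_le_sum[OF assms(2), of "\<lambda>\<rho>. indicat_real (tethered R J \<rho>) h"] assms
  by (simp add: finite_sparse_retractions)

context mixing_observable
begin

lemma f_AE_bounded: "\<exists>B\<ge>1. AE x in M. \<bar>f x\<bar> \<le> B"
proof -
  obtain C where "\<forall>u\<in>A. AE x in M. \<bar>u x\<bar> \<le> C * N 1 u"
    using seminorms unfolding adm_seminorms_def by blast
  then have "AE x in M. \<bar>f x\<bar> \<le> C * N 1 f" using fA by blast
  then have "AE x in M. \<bar>f x\<bar> \<le> max 1 (C * N 1 f)"
    by eventually_elim auto
  then show ?thesis by (intro exI[of _ "max 1 (C * N 1 f)"]) auto
qed

definition ess_bound :: real where
  "ess_bound = (SOME B. 1 \<le> B \<and> (AE x in M. \<bar>f x\<bar> \<le> B))"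

lemma ess_bound: "1 \<le> ess_bound" "AE x in M. \<bar>f x\<bar> \<le> ess_bound"
  using someI_ex[OF f_AE_bounded] unfolding ess_bound_def by auto

text \<open>Members of the algebra are only almost everywhere bounded; the truncation makes the integrands
  in Fubini's theorem bounded everywhere without changing any correlation.\<close>

definition f_trunc :: "'x \<Rightarrow> real" where
  "f_trunc x = (if \<bar>f x\<bar> \<le> ess_bound then f x else 0)"

lemma f_trunc_measurable[measurable]: "f_trunc \<in> borel_measurable M"
  unfolding f_trunc_def by measurable

lemma abs_f_trunc_le: "\<bar>f_trunc x\<bar> \<le> ess_bound"
  using ess_bound(1) by (auto simp: f_trunc_def)

lemma AE_trans_fun_eq_trunc: "AE x in M. trans_fun act h f x = f_trunc (act (- h) x)"
proof -
  have "AE x in distr M M (act (- h)). f x = f_trunc x"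
    unfolding act_preserving using ess_bound(2) by eventually_elim (simp add: f_trunc_def)
  then show ?thesis
    by (subst (asm) AE_distr_iff) (auto simp: trans_fun_def)
qed

lemma corr_eq_trunc:
  assumes "finite J"
  shows "corr J h = (\<integral>x. (\<Prod>i\<in>J. f_trunc (act (- h i) x)) \<partial>M)"
proof -
  have "AE x in M. \<forall>i\<in>J. trans_fun act (h i) f x = f_trunc (act (- h i) x)"
    using assms by (intro AE_finite_allI AE_trans_fun_eq_trunc)
  then have "AE x in M. (\<Prod>i\<in>J. trans_fun act (h i) f x) = (\<Prod>i\<in>J. f_trunc (act (- h i) x))"
    by eventually_elim auto
  moreover have "trans_fun act (h i) f \<in> borel_measurable M" for i
    by (intro A_measurable A_trans_fun fA)
  ultimately show ?thesis
    unfolding corr_def correlation_def by (intro integral_cong_AE borel_measurable_prod) auto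
qed

definition corr_bound :: "'i set \<Rightarrow> real" where
  "corr_bound J = ess_bound ^ card J"

lemma corr_bound_ge_1: "1 \<le> corr_bound J"
  unfolding corr_bound_def by (rule one_le_power[OF ess_bound(1)])

lemma abs_corr_le:
  assumes "finite J" "I \<subseteq> J"
  shows "\<bar>corr I h\<bar> \<le> corr_bound J"
proof -
  have "finite I" using assms by (rule rev_finite_subset)
  have le: "\<bar>\<Prod>i\<in>I. f_trunc (act (- h i) x)\<bar> \<le> corr_bound J" for x
  proof -
    have "(\<Prod>i\<in>I. \<bar>f_trunc (act (- h i) x)\<bar>) \<le> (\<Prod>i\<in>I. ess_bound)"
      by (intro prod_mono conjI abs_ge_zero abs_f_trunc_le)
    also have "\<dots> \<le> corr_bound J"
      using ess_bound(1) assms by (simp add: corr_bound_def card_mono power_increasing)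
    finally show ?thesis by (simp add: abs_prod)
  qed
  have "\<bar>corr I h\<bar> \<le> (\<integral>x. \<bar>\<Prod>i\<in>I. f_trunc (act (- h i) x)\<bar> \<partial>M)"
    unfolding corr_eq_trunc[OF \<open>finite I\<close>] by (rule integral_abs_bound)
  also have "\<dots> \<le> corr_bound J"
    using le by (intro integral_le_const integrable_const_bound[of _ "corr_bound J"]) auto
  finally show ?thesis .
qed

definition factorizes :: "real \<Rightarrow> 'i set \<Rightarrow> ('i \<Rightarrow> 'h) \<Rightarrow> 'i set set \<Rightarrow> bool" where
  "factorizes \<epsilon> J h P \<longleftrightarrow> partition_on J P \<and> (\<forall>I\<subseteq>J. \<bar>corr I h - (\<Prod>c\<in>P. corr (I \<inter> c) h)\<bar> \<le> \<epsilon>)"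

lemma factorizesD:
  assumes "factorizes \<epsilon> J h P" "I \<subseteq> J"
  shows "\<bar>corr I h - (\<Prod>c\<in>P. corr (I \<inter> c) h)\<bar> \<le> \<epsilon>"
  using assms by (simp add: factorizes_def)

lemma factorizes_nonneg: "factorizes \<epsilon> J h P \<Longrightarrow> 0 \<le> \<epsilon>"
  using factorizesD[of \<epsilon> J h P J] abs_ge_zero order_trans by blast

lemma prod_corr_Int:
  assumes "finite J" "partition_on J P" "I \<subseteq> J"
  shows "(\<Prod>d\<in>(\<inter>) I ` P - {{}}. corr d h) = (\<Prod>c\<in>P. corr (I \<inter> c) h)"
proof -
  have "finite P" by (rule finite_elements[OF assms(1,2)])
  have inj: "inj_on ((\<inter>) I) {c \<in> P. I \<inter> c \<noteq> {}}"
    using partition_onD2[OF assms(2)] by (auto simp: inj_on_def disjoint_def)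
  have "(\<inter>) I ` P - {{}} = (\<inter>) I ` {c \<in> P. I \<inter> c \<noteq> {}}" by auto
  then have "(\<Prod>d\<in>(\<inter>) I ` P - {{}}. corr d h) = (\<Prod>c\<in>{c \<in> P. I \<inter> c \<noteq> {}}. corr (I \<inter> c) h)"
    by (simp add: prod.reindex[OF inj])
  also have "\<dots> = (\<Prod>c\<in>P. corr (I \<inter> c) h)"
    using \<open>finite P\<close> by (intro prod.mono_neutral_left) (auto simp: corr_empty)
  finally show ?thesis .
qed

lemma prod_corr_Int_remove:
  assumes "finite J" "partition_on J P" "d \<in> P" "J - d \<subseteq> I"
  shows "(\<Prod>c\<in>P. corr (I \<inter> c) h) = corr (I \<inter> d) h * (\<Prod>c\<in>P - {d}. corr c h)"
proof -
  have "I \<inter> c = c" if "c \<in> P - {d}" for c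
    using partition_onD1[OF assms(2)] disjointD[OF partition_onD2[OF assms(2)] assms(3)]
      assms(4) that
    by blast
  then have "(\<Prod>c\<in>P - {d}. corr (I \<inter> c) h) = (\<Prod>c\<in>P - {d}. corr c h)"
    by (intro prod.cong) auto
  then show ?thesis
    using prod.remove[OF finite_elements[OF assms(1,2)] assms(3)] by metis
qed

lemma clustering_imp_factorizes:
  fixes J :: "'i set"
  assumes "finite J"
  obtains C K where "C \<ge> 0" "K \<ge> 2"
    "\<And>h D P. D \<ge> 0 \<Longrightarrow> clustering D (K * D) J h P \<Longrightarrow> factorizes (C * exp (- D)) J h P"
proof -
  obtain C K where C: "C \<ge> 0" and K: "K \<ge> 2" and factorization:
    "\<And>(I :: 'i set) h D P. finite I \<Longrightarrow> card I \<le> card J \<Longrightarrow> D \<ge> 0 \<Longrightarrow> clustering D (K * D) I h P \<Longrightarrow>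
      \<bar>corr I h - (\<Prod>c\<in>P. corr c h)\<bar> \<le> C * exp (- D)"
    by (rule corr_factorization[of "card J"]) blast
  have "factorizes (C * exp (- D)) J h P"
    if D: "D \<ge> 0" and P: "clustering D (K * D) J h P" for h D P
    unfolding factorizes_def
  proof (intro conjI allI impI)
    show part: "partition_on J P" using P by (simp add: clustering_def)
    fix I assume "I \<subseteq> J"
    then show "\<bar>corr I h - (\<Prod>c\<in>P. corr (I \<inter> c) h)\<bar> \<le> C * exp (- D)"
      using factorization[OF _ _ D clustering_Int[OF P \<open>I \<subseteq> J\<close>]] assms
      by (simp add: prod_corr_Int[OF assms part] card_mono finite_subset)
  qed
  with C K show ?thesis by (rule that)
qed

lemma abs_corr_le_if_isolated:
  assumes "finite J" "factorizes \<epsilon> J h P" "I \<subseteq> J" "c \<in> P" "I \<inter> c = {i}"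
  shows "\<bar>corr I h\<bar> \<le> \<epsilon>"
proof -
  have "finite P"
    using assms finite_elements by (auto simp: factorizes_def)
  then have "(\<Prod>c\<in>P. corr (I \<inter> c) h) = 0"
    using assms(4,5) corr_singleton[of i h] by (intro prod_zero bexI[of _ c]) auto
  then show ?thesis
    using factorizesD[OF assms(2,3)] by simp
qed

definition pairing_sum :: "'i \<Rightarrow> 'i set \<Rightarrow> ('i \<Rightarrow> 'h) \<Rightarrow> real" where
  "pairing_sum i J h = (\<Sum>j\<in>J - {i}. corr {i, j} h * corr (J - {i, j}) h)"

lemma abs_pairing_term_le:
  assumes "finite J" "i \<in> J" "j \<in> J" "\<bar>corr {i, j} h\<bar> \<le> \<epsilon> \<or> \<bar>corr (J - {i, j}) h\<bar> \<le> \<epsilon>"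
  shows "\<bar>corr {i, j} h * corr (J - {i, j}) h\<bar> \<le> corr_bound J * \<epsilon>"
proof -
  have "\<bar>corr {i, j} h\<bar> \<le> corr_bound J" "\<bar>corr (J - {i, j}) h\<bar> \<le> corr_bound J"
    using assms by (auto intro: abs_corr_le)
  then have "\<bar>corr {i, j} h\<bar> * \<bar>corr (J - {i, j}) h\<bar> \<le> corr_bound J * \<epsilon> \<or>
      \<bar>corr (J - {i, j}) h\<bar> * \<bar>corr {i, j} h\<bar> \<le> corr_bound J * \<epsilon>"
    using assms(4) corr_bound_ge_1[of J] by (elim disjE) (auto intro: mult_mono)
  then show ?thesis by (simp add: abs_mult mult.commute)
qed

lemma abs_sum_pairing_terms_le:
  assumes "finite J" "S \<subseteq> J" "\<epsilon> \<ge> 0"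
    and "\<And>j. j \<in> S \<Longrightarrow> \<bar>corr {i, j} h * corr (J - {i, j}) h\<bar> \<le> corr_bound J * \<epsilon>"
  shows "\<bar>\<Sum>j\<in>S. corr {i, j} h * corr (J - {i, j}) h\<bar> \<le> card J * corr_bound J * \<epsilon>"
proof -
  have "\<bar>\<Sum>j\<in>S. corr {i, j} h * corr (J - {i, j}) h\<bar> \<le> card S * (corr_bound J * \<epsilon>)"
    using assms(4) sum_norm_bound[of S "\<lambda>j. corr {i, j} h * corr (J - {i, j}) h"] by simp
  also have "\<dots> \<le> card J * (corr_bound J * \<epsilon>)"
    using assms corr_bound_ge_1[of J] by (intro mult_right_mono) (auto simp: card_mono)
  finally show ?thesis by (simp add: mult.assoc)
qed

lemma corr_recursion_singleton_cluster:
  assumes J: "finite J" "i \<in> J" and P: "factorizes \<epsilon> J h P" "{k} \<in> P"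
  shows "\<bar>corr J h - pairing_sum i J h\<bar> \<le> (1 + card J * corr_bound J) * \<epsilon>"
proof -
  have "k \<in> J"
    using P partition_onD1 by (force simp: factorizes_def)
  note isolated = abs_corr_le_if_isolated[OF J(1) P(1) _ P(2), of _ k]
  have "\<bar>corr {i, j} h\<bar> \<le> \<epsilon> \<or> \<bar>corr (J - {i, j}) h\<bar> \<le> \<epsilon>" if "j \<in> J" for j
    using isolated[of "{i, j}"] isolated[of "J - {i, j}"] J(2) that \<open>k \<in> J\<close>
    by (cases "k \<in> {i, j}") auto
  then have "\<bar>pairing_sum i J h\<bar> \<le> card J * corr_bound J * \<epsilon>"
    unfolding pairing_sum_def using J factorizes_nonneg[OF P(1)]
    by (intro abs_sum_pairing_terms_le abs_pairing_term_le) auto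
  moreover have "\<bar>corr J h\<bar> \<le> \<epsilon>"
    using isolated[of J] \<open>k \<in> J\<close> by auto
  ultimately show ?thesis by (simp add: algebra_simps)
qed

lemma corr_recursion_pair_cluster:
  assumes J: "finite J" "i \<in> J" and P: "factorizes \<epsilon> J h P" "{i, j} \<in> P" "i \<noteq> j"
  shows "\<bar>corr J h - pairing_sum i J h\<bar> \<le> (1 + corr_bound J + card J * corr_bound J) * \<epsilon>"
proof -
  have part: "partition_on J P" using P(1) by (simp add: factorizes_def)
  have "j \<in> J" using P(2) partition_onD1[OF part] by auto
  define rest where "rest = (\<Prod>c\<in>P - {{i, j}}. corr c h)"
  note split = prod_corr_Int_remove[OF J(1) part P(2), where h = h, folded rest_def]
  have "\<bar>corr J h - corr {i, j} h * rest\<bar> \<le> \<epsilon>"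
    using factorizesD[OF P(1) order_refl] split[of J] J(2) \<open>j \<in> J\<close> by (simp add: Int_absorb1)
  moreover have "\<bar>corr {i, j} h * corr (J - {i, j}) h - corr {i, j} h * rest\<bar> \<le> corr_bound J * \<epsilon>"
  proof -
    have "\<bar>corr (J - {i, j}) h - rest\<bar> \<le> \<epsilon>"
      using factorizesD[OF P(1), of "J - {i, j}"] split[of "J - {i, j}"] by (simp add: corr_empty)
    then have "\<bar>corr {i, j} h\<bar> * \<bar>corr (J - {i, j}) h - rest\<bar> \<le> corr_bound J * \<epsilon>"
      using corr_bound_ge_1[of J] J \<open>j \<in> J\<close> by (intro mult_mono abs_corr_le) auto
    then show ?thesis by (simp add: abs_mult[symmetric] right_diff_distrib)
  qed
  moreover have "\<bar>\<Sum>k\<in>J - {i} - {j}. corr {i, k} h * corr (J - {i, k}) h\<bar>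
      \<le> card J * corr_bound J * \<epsilon>"
  proof (intro abs_sum_pairing_terms_le abs_pairing_term_le disjI1)
    fix k assume "k \<in> J - {i} - {j}"
    then show "\<bar>corr {i, k} h\<bar> \<le> \<epsilon>"
      using J P(3) by (intro abs_corr_le_if_isolated[OF J(1) P(1) _ P(2), of _ i]) auto
  qed (use J factorizes_nonneg[OF P(1)] in auto)
  moreover have "pairing_sum i J h = corr {i, j} h * corr (J - {i, j}) h
      + (\<Sum>k\<in>J - {i} - {j}. corr {i, k} h * corr (J - {i, k}) h)"
    unfolding pairing_sum_def using J(1) \<open>j \<in> J\<close> P(3) by (intro sum.remove) auto
  ultimately have "\<bar>corr J h - pairing_sum i J h\<bar>
      \<le> \<epsilon> + corr_bound J * \<epsilon> + card J * corr_bound J * \<epsilon>"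
    by linarith
  then show ?thesis by (simp add: algebra_simps)
qed

lemma abs_corr_diff_pairing_sum_le:
  assumes "finite J" "i \<in> J"
  shows "\<bar>corr J h - pairing_sum i J h\<bar> \<le> corr_bound J + card J * corr_bound J * corr_bound J"
proof -
  have "\<bar>pairing_sum i J h\<bar> \<le> card J * corr_bound J * corr_bound J"
    unfolding pairing_sum_def using assms corr_bound_ge_1[of J]
    by (intro abs_sum_pairing_terms_le abs_pairing_term_le disjI1 abs_corr_le) auto
  then show ?thesis
    using abs_corr_le[OF assms(1) order_refl, of h] by linarith
qed

lemma corr_recursion_tethered:
  assumes J: "finite J" "i \<in> J" and P: "factorizes \<epsilon> J h P"
    and close: "\<And>c k l. c \<in> P \<Longrightarrow> k \<in> c \<Longrightarrow> l \<in> c \<Longrightarrow> dist (h k) (h l) \<le> R"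
  shows "\<bar>corr J h - pairing_sum i J h\<bar> \<le> (1 + corr_bound J + card J * corr_bound J) * \<epsilon>
    + (corr_bound J + card J * corr_bound J * corr_bound J) * tethered_count R J h"
    (is "_ \<le> ?C1 * \<epsilon> + ?C2 * ?count")
proof -
  have part: "partition_on J P" using P by (simp add: factorizes_def)
  have nonneg: "0 \<le> ?C1 * \<epsilon>" "0 \<le> ?C2" "0 \<le> ?C2 * ?count"
    using corr_bound_ge_1[of J] factorizes_nonneg[OF P]
    tethered_count_nonneg[of R J h]
    by (auto intro!: mult_nonneg_nonneg)
  from part J show ?thesis
  proof (cases rule: partition_on_cases_singleton_pair_sparse)
    case (singleton k)
    have "(1 + card J * corr_bound J) * \<epsilon> \<le> ?C1 * \<epsilon>"
      using corr_bound_ge_1[of J] factorizes_nonneg[OF P] by (intro mult_right_mono) auto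
    then show ?thesis
      using corr_recursion_singleton_cluster[OF J P singleton] nonneg(3) by linarith
  next
    case (pair j)
    then show ?thesis
      using corr_recursion_pair_cluster[OF J P pair] nonneg(3) by linarith
  next
    case sparse
    obtain \<rho> where \<rho>: "\<rho> \<in> sparse_retractions J" "\<And>k. k \<in> J \<Longrightarrow> \<exists>c\<in>P. k \<in> c \<and> \<rho> k \<in> c"
      by (rule partition_on_sparse_retraction[OF part J(1) sparse]) blast
    have "h \<in> tethered R J \<rho>"
      using \<rho>(2) close unfolding tethered_def by blast
    note count = one_le_tethered_count[OF J(1) \<rho>(1) this]
    have "\<bar>corr J h - pairing_sum i J h\<bar> \<le> ?C2 * 1"
      using abs_corr_diff_pairing_sum_le[OF J, of h] by simp
    also have "\<dots> \<le> ?C2 * ?count"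
      using count nonneg(2) by (rule mult_left_mono)
    finally show ?thesis
      using nonneg(1) by linarith
  qed
qed

lemma corr_recursion:
  fixes J :: "'i set"
  assumes J: "finite J" "i \<in> J"
  obtains C L where "C \<ge> 0" "L \<ge> 0" "\<And>h D. D \<ge> 0 \<Longrightarrow>
    \<bar>corr J h - pairing_sum i J h\<bar> \<le> C * (exp (- D) + tethered_count (L * D) J h)"
proof -
  obtain C K where C: "C \<ge> 0" and K: "K \<ge> 2" and factorizes:
    "\<And>h D P. D \<ge> 0 \<Longrightarrow> clustering D (K * D) J h P \<Longrightarrow> factorizes (C * exp (- D)) J h P"
    by (rule clustering_imp_factorizes[OF J(1)]) blast
  define L where "L = K ^ (card J * card J)"
  define C1 where "C1 = (1 + corr_bound J + card J * corr_bound J) * C"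
  define C2 where "C2 = corr_bound J + card J * corr_bound J * corr_bound J"
  have nonneg: "C1 \<ge> 0" "C2 \<ge> 0" using C corr_bound_ge_1[of J] by (auto simp: C1_def C2_def)
  have "\<bar>corr J h - pairing_sum i J h\<bar> \<le> (C1 + C2) * (exp (- D) + tethered_count (L * D) J h)"
    if D: "D \<ge> 0" for h D
  proof -
    obtain D' P where D': "D \<le> D'" "D' \<le> L * D" and P: "clustering D' (K * D') J h P"
      using exists_clustering[OF J(1) K D, of h] unfolding L_def by blast
    have close: "dist (h k) (h l) \<le> L * D" if "c \<in> P" "k \<in> c" "l \<in> c" for c k l
      using P that D'(2) unfolding clustering_def by (meson order_trans)
    have "factorizes (C * exp (- D')) J h P"
      using factorizes[OF _ P] D D'(1) by simp
    from corr_recursion_tethered[OF J this, of "L * D"]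
    have "\<bar>corr J h - pairing_sum i J h\<bar> \<le> C1 * exp (- D') + C2 * tethered_count (L * D) J h"
      using close by (simp add: C1_def C2_def mult.assoc)
    also have "\<dots> \<le> (C1 + C2) * exp (- D) + (C1 + C2) * tethered_count (L * D) J h"
      using D'(1) nonneg by (intro add_mono mult_mono tethered_count_nonneg) auto
    finally show ?thesis by (simp add: distrib_left)
  qed
  moreover have "L \<ge> 0" using K by (simp add: L_def)
  ultimately show ?thesis
    using nonneg by (intro that[of "C1 + C2" L]) auto
qed

end

subsection \<open>Integration over tuples\<close>

lemma (in product_sigma_finite) emeasure_space_PiM:
  assumes "finite I"
  shows "emeasure (PiM I M) (space (PiM I M)) = (\<Prod>i\<in>I. emeasure (M i) (space (M i)))"
  unfolding space_PiM using assms by (intro emeasure_PiM) auto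

lemma finite_measure_PiM:
  assumes \<nu>: "\<And>i. finite_measure (\<nu> i)" and "finite I"
  shows "finite_measure (PiM I \<nu>)"
proof (rule finite_measureI)
  interpret \<nu>: finite_measure "\<nu> i" for i by (rule \<nu>)
  interpret product_sigma_finite \<nu> by standard
  show "emeasure (PiM I \<nu>) (space (PiM I \<nu>)) \<noteq> \<infinity>"
    using assms(2) by (simp add: emeasure_space_PiM ennreal_prod_eq_top)
qed

lemma measure_space_PiM:
  assumes \<nu>: "\<And>i. finite_measure (\<nu> i)" and "finite I"
  shows "measure (PiM I \<nu>) (space (PiM I \<nu>)) = (\<Prod>i\<in>I. measure (\<nu> i) (space (\<nu> i)))"
proof -
  interpret \<nu>: finite_measure "\<nu> i" for i by (rule \<nu>)
  interpret product_sigma_finite \<nu> by standard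
  show ?thesis
    unfolding measure_def emeasure_space_PiM[OF assms(2)]
    by (simp add: \<nu>.emeasure_eq_measure prod_ennreal prod_nonneg)
qed

lemma integrable_PiM_pair_prod:
  fixes G :: "'i \<Rightarrow> 'a \<Rightarrow> 'z \<Rightarrow> real"
  assumes \<nu>: "\<And>i. finite_measure (\<nu> i)" and P: "finite_measure P" and I: "finite I"
    and meas: "\<And>i. i \<in> I \<Longrightarrow> (\<lambda>(h, z). G i h z) \<in> borel_measurable (\<nu> i \<Otimes>\<^sub>M P)"
    and bounded: "\<And>i h z. \<bar>G i h z\<bar> \<le> B"
  shows "integrable (PiM I \<nu> \<Otimes>\<^sub>M P) (\<lambda>(h, z). \<Prod>i\<in>I. G i (h i) z)"
proof -
  interpret pair: finite_measure "PiM I \<nu> \<Otimes>\<^sub>M P"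
    by (intro finite_measure_pair_measure P finite_measure_PiM[OF \<nu> I])
  have [measurable]: "(\<lambda>p. G i (fst p i) (snd p)) \<in> borel_measurable (PiM I \<nu> \<Otimes>\<^sub>M P)"
    if "i \<in> I" for i
  proof -
    have "(\<lambda>p. (fst p i, snd p)) \<in> PiM I \<nu> \<Otimes>\<^sub>M P \<rightarrow>\<^sub>M \<nu> i \<Otimes>\<^sub>M P"
      using that by measurable
    from measurable_compose[OF this meas[OF that]] show ?thesis by simp
  qed
  show ?thesis
  proof (rule pair.integrable_const_bound[of _ "B ^ card I"])
    have "\<bar>\<Prod>i\<in>I. G i (h i) z\<bar> \<le> B ^ card I" for h z
      unfolding abs_prod using prod_mono[of I "\<lambda>i. \<bar>G i (h i) z\<bar>" "\<lambda>_. B"] bounded by simp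
    then show "AE p in PiM I \<nu> \<Otimes>\<^sub>M P. norm (case p of (h, z) \<Rightarrow> \<Prod>i\<in>I. G i (h i) z) \<le> B ^ card I"
      by auto
    show "(\<lambda>(h, z). \<Prod>i\<in>I. G i (h i) z) \<in> borel_measurable (PiM I \<nu> \<Otimes>\<^sub>M P)"
      unfolding split_beta' by (intro borel_measurable_prod) measurable
  qed
qed

lemma integral_PiM_prod_swap:
  fixes G :: "'i \<Rightarrow> 'a \<Rightarrow> 'z \<Rightarrow> real"
  assumes \<nu>: "\<And>i. finite_measure (\<nu> i)" and P: "finite_measure P" and I: "finite I"
    and meas: "\<And>i. i \<in> I \<Longrightarrow> (\<lambda>(h, z). G i h z) \<in> borel_measurable (\<nu> i \<Otimes>\<^sub>M P)"
    and bounded: "\<And>i h z. \<bar>G i h z\<bar> \<le> B"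
  shows "(\<integral>h. (\<integral>z. (\<Prod>i\<in>I. G i (h i) z) \<partial>P) \<partial>PiM I \<nu>) = (\<integral>z. (\<Prod>i\<in>I. \<integral>h. G i h z \<partial>\<nu> i) \<partial>P)"
proof -
  interpret \<nu>: finite_measure "\<nu> i" for i by (rule \<nu>)
  interpret P: finite_measure P by fact
  interpret \<Pi>: finite_measure "PiM I \<nu>" by (rule finite_measure_PiM[OF \<nu> I])
  interpret product_sigma_finite \<nu> by standard
  interpret pair: pair_sigma_finite "PiM I \<nu>" P by standard
  have "(\<integral>h. (\<integral>z. (\<Prod>i\<in>I. G i (h i) z) \<partial>P) \<partial>PiM I \<nu>)
      = (\<integral>z. (\<integral>h. (\<Prod>i\<in>I. G i (h i) z) \<partial>PiM I \<nu>) \<partial>P)"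
    using pair.Fubini_integral[OF integrable_PiM_pair_prod[OF assms]] by simp
  also have "\<dots> = (\<integral>z. (\<Prod>i\<in>I. \<integral>h. G i h z \<partial>\<nu> i) \<partial>P)"
  proof (rule Bochner_Integration.integral_cong[OF refl])
    fix z assume z: "z \<in> space P"
    have "integrable (\<nu> i) (\<lambda>h. G i h z)" if "i \<in> I" for i
    proof (rule \<nu>.integrable_const_bound[of _ B])
      show "(\<lambda>h. G i h z) \<in> borel_measurable (\<nu> i)"
        using measurable_compose[OF measurable_Pair2'[OF z] meas[OF that]] by simp
    qed (use bounded in auto)
    then show "(\<integral>h. (\<Prod>i\<in>I. G i (h i) z) \<partial>PiM I \<nu>) = (\<Prod>i\<in>I. \<integral>h. G i h z \<partial>\<nu> i)"
      using product_integral_prod[OF I, of "\<lambda>i h. G i h z"] by simp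
  qed
  finally show ?thesis .
qed

lemma tethered_measurable:
  fixes \<nu> :: "'h::{metric_space, second_countable_topology} measure"
  assumes \<nu>: "sets \<nu> = sets borel" and "finite Q" "Q \<subseteq> J" "\<rho> ` Q \<subseteq> J"
  shows "{h \<in> space (PiM J (\<lambda>_. \<nu>)). h \<in> tethered R Q \<rho>} \<in> sets (PiM J (\<lambda>_. \<nu>))"
proof -
  have coord: "(\<lambda>h. h i) \<in> borel_measurable (PiM J (\<lambda>_. \<nu>))" if "i \<in> J" for i
    using measurable_component_singleton[OF that, of "\<lambda>_. \<nu>"]
    by (simp add: measurable_cong_sets[OF refl \<nu>])
  have "{h \<in> space (PiM J (\<lambda>_. \<nu>)). dist (h i) (h (\<rho> i)) \<le> R} \<in> sets (PiM J (\<lambda>_. \<nu>))"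
    if "i \<in> Q" for i
    using assms that
    by (intro borel_measurable_le borel_measurable_dist coord borel_measurable_const) auto
  then show ?thesis
    unfolding tethered_def mem_Collect_eq using assms(2) by (intro sets.sets_Collect_finite_All)
qed

lemma indicator_tethered_insert:
  assumes "q \<notin> Q" "\<rho> q \<noteq> q" "q \<notin> \<rho> ` Q"
  shows "indicator (tethered R (insert q Q) \<rho>) (x(q := y))
    = (indicator (tethered R Q \<rho>) x * indicator (cball (x (\<rho> q)) R) y :: 'b::semiring_1)"
  using assms by (auto simp: tethered_def indicator_def dist_commute)

text \<open>Integrate out the points of Q one at a time: each is confined to a ball around its root.\<close>

lemma nn_integral_tethered_le:
  fixes \<nu> :: "'h::{metric_space, second_countable_topology} measure"
  assumes \<nu>: "finite_measure \<nu>" and sets: "sets \<nu> = sets borel"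
    and ball: "\<And>g. emeasure \<nu> (cball g R) \<le> v"
    and I: "finite I" and Q: "finite Q" "I \<inter> Q = {}" "\<rho> ` Q \<subseteq> I"
  shows "(\<integral>\<^sup>+ h. indicator (tethered R Q \<rho>) h \<partial>PiM (I \<union> Q) (\<lambda>_. \<nu>))
    \<le> emeasure \<nu> (space \<nu>) ^ card I * v ^ card Q"
proof -
  interpret \<nu>: finite_measure \<nu> by fact
  interpret product_sigma_finite "\<lambda>_. \<nu>" by standard
  show ?thesis
    using Q
  proof (induction Q)
    case empty
    show ?case
      using emeasure_space_PiM[OF I] by (simp add: tethered_def)
  next
    case (insert q Q)
    let ?\<Pi> = "\<lambda>J. PiM J (\<lambda>_. \<nu>)"
    have q: "q \<notin> I \<union> Q" "finite (I \<union> Q)" "\<rho> q \<noteq> q" "q \<notin> \<rho> ` Q"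
      using insert I by auto
    have upd: "indicator (tethered R (insert q Q) \<rho>) (x(q := y))
        = indicator (tethered R Q \<rho>) x * (indicator (cball (x (\<rho> q)) R) y :: ennreal)" for x y
      using insert q by (intro indicator_tethered_insert) auto
    have "(\<integral>\<^sup>+ h. indicator (tethered R (insert q Q) \<rho>) h \<partial>?\<Pi> (I \<union> insert q Q))
        = (\<integral>\<^sup>+ x. (\<integral>\<^sup>+ y. indicator (tethered R (insert q Q) \<rho>) (x(q := y)) \<partial>\<nu>) \<partial>?\<Pi> (I \<union> Q))"
      unfolding Un_insert_right using insert q
      by (intro product_nn_integral_insert borel_measurable_indicator'
          tethered_measurable[OF sets]) auto
    also have "\<dots>
        = (\<integral>\<^sup>+ x. indicator (tethered R Q \<rho>) x * emeasure \<nu> (cball (x (\<rho> q)) R) \<partial>?\<Pi> (I \<union> Q))"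
      unfolding upd by (simp add: nn_integral_cmult_indicator sets)
    also have "\<dots> \<le> (\<integral>\<^sup>+ x. indicator (tethered R Q \<rho>) x * v \<partial>?\<Pi> (I \<union> Q))"
      by (intro nn_integral_mono mult_left_mono ball) auto
    also have "\<dots> = (\<integral>\<^sup>+ x. indicator (tethered R Q \<rho>) x \<partial>?\<Pi> (I \<union> Q)) * v"
      using insert
      by (intro nn_integral_multc borel_measurable_indicator' tethered_measurable[OF sets]) auto
    also have "\<dots> \<le> emeasure \<nu> (space \<nu>) ^ card I * v ^ card Q * v"
      using insert by (intro mult_right_mono insert.IH) auto
    also have "\<dots> = emeasure \<nu> (space \<nu>) ^ card I * v ^ card (insert q Q)"
      using insert by (simp add: mult_ac)
    finally show ?case .
  qed
qed

lemma integral_tethered_le: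
  fixes \<nu> :: "'h::{metric_space, second_countable_topology} measure"
  assumes \<nu>: "finite_measure \<nu>" and sets: "sets \<nu> = sets borel"
    and ball: "\<And>g. emeasure \<nu> (cball g R) \<le> ennreal v" and v: "0 \<le> v"
    and J: "finite J" and \<rho>: "\<rho> \<in> sparse_retractions J"
  shows "integrable (PiM J (\<lambda>_. \<nu>)) (indicat_real (tethered R J \<rho>))"
    and "(\<integral>h. indicat_real (tethered R J \<rho>) h \<partial>PiM J (\<lambda>_. \<nu>))
      \<le> measure \<nu> (space \<nu>) ^ card (\<rho> ` J) * v ^ (card J - card (\<rho> ` J))"
proof -
  interpret \<nu>: finite_measure \<nu> by fact
  interpret \<Pi>: finite_measure "PiM J (\<lambda>_. \<nu>)" by (rule finite_measure_PiM[OF \<nu> J])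
  let ?\<Pi> = "PiM J (\<lambda>_. \<nu>)"
  define Q where "Q = J - \<rho> ` J"
  have \<rho>J: "\<rho> ` J \<subseteq> J" "\<rho> ` J \<union> Q = J"
    using \<rho> by (auto simp: sparse_retractions_def Q_def)
  show int: "integrable ?\<Pi> (indicat_real (tethered R J \<rho>))"
    using tethered_measurable[OF sets J order_refl \<rho>J(1)]
    by (intro \<Pi>.integrable_const_bound[of _ 1] borel_measurable_indicator') simp_all
  have "ennreal (\<integral>h. indicat_real (tethered R J \<rho>) h \<partial>?\<Pi>)
      = (\<integral>\<^sup>+ h. indicator (tethered R J \<rho>) h \<partial>?\<Pi>)"
    by (subst nn_integral_eq_integral[OF int, symmetric]) (simp_all add: ennreal_indicator)
  also have "\<dots> \<le> (\<integral>\<^sup>+ h. indicator (tethered R Q \<rho>) h \<partial>?\<Pi>)"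
    by (intro nn_integral_mono) (auto simp: indicator_def tethered_def Q_def)
  also have "\<dots> \<le> emeasure \<nu> (space \<nu>) ^ card (\<rho> ` J) * ennreal v ^ card Q"
    using nn_integral_tethered_le[OF \<nu> sets ball, of "\<rho> ` J" Q \<rho>] J unfolding \<rho>J(2)
    by (auto simp: Q_def)
  also have "\<dots> = ennreal (measure \<nu> (space \<nu>) ^ card (\<rho> ` J) * v ^ card Q)"
    using v by (simp add: \<nu>.emeasure_eq_measure ennreal_mult ennreal_power)
  finally have "(\<integral>h. indicat_real (tethered R J \<rho>) h \<partial>?\<Pi>)
      \<le> measure \<nu> (space \<nu>) ^ card (\<rho> ` J) * v ^ card Q"
    using v by (subst (asm) ennreal_le_iff) auto
  then show "(\<integral>h. indicat_real (tethered R J \<rho>) h \<partial>?\<Pi>)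
      \<le> measure \<nu> (space \<nu>) ^ card (\<rho> ` J) * v ^ (card J - card (\<rho> ` J))"
    using J \<rho>J(1) by (simp add: Q_def card_Diff_subset)
qed

definition tethered_weight :: "'i set \<Rightarrow> real \<Rightarrow> real \<Rightarrow> real" where
  "tethered_weight J V v
    = (\<Sum>\<rho>\<in>sparse_retractions J. V ^ card (\<rho> ` J) * v ^ (card J - card (\<rho> ` J)))"

lemma integral_tethered_count_le:
  fixes \<nu> :: "'h::{metric_space, second_countable_topology} measure"
  assumes "finite_measure \<nu>" "sets \<nu> = sets borel"
    and "\<And>g. emeasure \<nu> (cball g R) \<le> ennreal v" "0 \<le> v" "finite J"
  shows "integrable (PiM J (\<lambda>_. \<nu>)) (tethered_count R J)"
    and "(\<integral>h. tethered_count R J h \<partial>PiM J (\<lambda>_. \<nu>)) \<le> tethered_weight J (measure \<nu> (space \<nu>)) v"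
  unfolding tethered_count_def[abs_def] tethered_weight_def using integral_tethered_le[OF assms]
  by (auto simp: Bochner_Integration.integral_sum simp del: Bochner_Integration.integral_indicator
      intro!: sum_mono)

lemma power_mult_power_le_powr:
  fixes V v B :: real and r c :: nat
  assumes "V \<ge> 1" "B \<ge> 1" "2 * c < r" "0 \<le> v" "v \<le> B * V powr (1 / (4 * r))"
  shows "V ^ c * v ^ (r - c) \<le> B ^ r * V powr (r / 2 - 1 / 4)"
proof -
  have "1 * 1 \<le> B * V powr (1 / (4 * r))"
    using assms by (intro mult_mono) (auto intro: ge_one_powr_ge_zero)
  have "v ^ (r - c) \<le> (B * V powr (1 / (4 * r))) ^ (r - c)"
    using assms by (intro power_mono)
  also have "\<dots> \<le> (B * V powr (1 / (4 * r))) ^ r"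
    using \<open>1 * 1 \<le> B * V powr (1 / (4 * r))\<close> by (intro power_increasing) auto
  also have "\<dots> = B ^ r * V powr (1 / 4)"
    using assms by (simp add: power_mult_distrib powr_power)
  finally have "v ^ (r - c) \<le> B ^ r * V powr (1 / 4)" .
  moreover have "V ^ c \<le> V powr (r / 2 - 1 / 2)"
  proof -
    have "real c \<le> r / 2 - 1 / 2" using assms(3) by linarith
    then show ?thesis
      using assms(1) by (simp add: powr_realpow[symmetric] powr_mono)
  qed
  ultimately have "V ^ c * v ^ (r - c) \<le> V powr (r / 2 - 1 / 2) * (B ^ r * V powr (1 / 4))"
    using assms by (intro mult_mono) auto
  also have "\<dots> = B ^ r * V powr ((r / 2 - 1 / 2) + 1 / 4)"
    by (simp only: powr_add mult.left_commute)
  finally show ?thesis by simp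
qed

lemma tethered_weight_le_powr:
  assumes "V \<ge> 1" "B \<ge> 1" "0 \<le> v" "v \<le> B * V powr (1 / (4 * card J))"
  shows "tethered_weight J V v
    \<le> card (sparse_retractions J) * (B ^ card J * V powr (card J / 2 - 1 / 4))"
  unfolding tethered_weight_def using assms
  by (intro sum_bounded_above power_mult_power_le_powr) (auto simp: sparse_retractions_def)

subsection \<open>Haar measure and volume growth\<close>

locale haar_group =
  fixes m :: "'h::{metric_space, second_countable_topology, group_add} measure"
  assumes continuous_plus: "continuous_on UNIV (\<lambda>p::'h \<times> 'h. fst p + snd p)"
    and continuous_uminus: "continuous_on UNIV (uminus :: 'h \<Rightarrow> 'h)"
    and dist_plus_left: "dist (g + x) (g + y) = dist x (y::'h)"
    and compact_cball_0: "compact (cball (0::'h) r)"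
    and haar: "left_haar m"
begin

lemma sets_m[measurable_cong, simp]: "sets m = sets borel"
  using haar by (simp add: left_haar_def)

lemma space_m[simp]: "space m = UNIV"
  using sets_eq_imp_space_eq[OF sets_m] by simp

lemma emeasure_translate: "B \<in> sets borel \<Longrightarrow> emeasure m ((\<lambda>x. g + x) ` B) = emeasure m B"
  using haar by (auto simp: left_haar_def)

lemma compact_borel: "compact K \<Longrightarrow> K \<in> sets borel" for K :: "'h set"
  by (simp add: borel_closed compact_imp_closed)

lemma compact_fmeasurable: "compact K \<Longrightarrow> K \<in> fmeasurable m"
  using haar by (intro fmeasurableI) (auto simp: left_haar_def compact_borel)

lemma measure_pos:
  assumes "compact F" "interior F \<noteq> {}"
  shows "measure m F > 0"
proof -
  have "0 < emeasure m (interior F)"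
    using haar assms(2) by (auto simp: left_haar_def)
  also have "\<dots> \<le> emeasure m F"
    using assms(1) by (intro emeasure_mono interior_subset) (simp add: compact_borel)
  finally show ?thesis
    using fmeasurableD2[OF compact_fmeasurable[OF assms(1)]]
    by (simp add: measure_def enn2real_positive_iff top.not_eq_extremum)
qed

definition vol :: "real \<Rightarrow> real" where
  "vol R = measure m (cball 0 R)"

lemma emeasure_cball: "emeasure m (cball g R) = ennreal (vol R)"
proof -
  have "(\<lambda>x. g + x) ` cball 0 R = cball g R"
  proof (intro equalityI subsetI)
    fix y assume "y \<in> cball g R"
    then have "- g + y \<in> cball 0 R"
      using dist_plus_left[of "- g" g y] by simp
    then show "y \<in> (\<lambda>x. g + x) ` cball 0 R"
      by (intro image_eqI[of _ _ "- g + y"]) (simp_all add: add.assoc[symmetric])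
  qed (use dist_plus_left[of g 0] in auto)
  then have "emeasure m (cball g R) = emeasure m (cball 0 R)"
    using emeasure_translate[of "cball 0 R" g] by simp
  also have "\<dots> = ennreal (vol R)"
    unfolding vol_def using fmeasurableD2[OF compact_fmeasurable[OF compact_cball_0]]
    by (intro emeasure_eq_ennreal_measure)
  finally show ?thesis .
qed

lemma vol_nonneg: "0 \<le> vol R"
  by (simp add: vol_def)

sublocale m: sigma_finite_measure m
proof
  let ?B = "range (\<lambda>n::nat. cball (0::'h) (real n))"
  have "\<Union>?B = space m"
    using real_arch_simple by auto
  then show "\<exists>B. countable B \<and> B \<subseteq> sets m \<and> \<Union>B = space m \<and> (\<forall>a\<in>B. emeasure m a \<noteq> \<infinity>)"
    by (intro exI[of _ ?B]) (auto simp: emeasure_cball)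
qed

lemma measurable_uminus_borel[measurable]: "(uminus :: 'h \<Rightarrow> 'h) \<in> borel_measurable borel"
  by (rule borel_measurable_continuous_onI[OF continuous_uminus])

lemma measurable_plus_borel[measurable]:
  assumes [measurable]: "u \<in> borel_measurable P" "w \<in> borel_measurable P"
  shows "(\<lambda>x. u x + w x :: 'h) \<in> borel_measurable P"
proof -
  have "(\<lambda>x. (u x, w x)) \<in> P \<rightarrow>\<^sub>M borel"
    unfolding borel_prod[symmetric] by measurable
  from measurable_compose[OF this borel_measurable_continuous_onI[OF continuous_plus]] show ?thesis
    by simp
qed

lemma integral_translate:
  fixes u :: "'h \<Rightarrow> real"
  assumes [measurable]: "u \<in> borel_measurable borel"
  shows "(\<integral>h. u (g + h) \<partial>m) = (\<integral>h. u h \<partial>m)"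
proof -
  have [measurable]: "(\<lambda>x. g + x) \<in> m \<rightarrow>\<^sub>M m"
    by measurable
  have "distr m m (\<lambda>x. g + x) = m"
  proof (rule measure_eqI)
    fix B assume "B \<in> sets (distr m m (\<lambda>x. g + x))"
    then have B: "B \<in> sets borel" by simp
    have "(\<lambda>x. g + x) -` B = (\<lambda>x. - g + x) ` B"
      by (force simp: add.assoc[symmetric])
    then show "emeasure (distr m m (\<lambda>x. g + x)) B = emeasure m B"
      using emeasure_translate[OF B, of "- g"] B by (simp add: emeasure_distr)
  qed simp
  then have "(\<integral>h. u h \<partial>m) = (\<integral>h. u h \<partial>distr m m (\<lambda>x. g + x))" by simp
  also have "\<dots> = (\<integral>h. u (g + h) \<partial>m)"
    by (rule integral_distr) auto
  finally show ?thesis by simp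
qed

definition haar_on :: "'h set \<Rightarrow> 'h measure" where
  "haar_on F = density m (indicator F)"

lemma sets_haar_on[measurable_cong, simp]: "sets (haar_on F) = sets borel"
  by (simp add: haar_on_def)

lemma space_haar_on[simp]: "space (haar_on F) = UNIV"
  by (simp add: haar_on_def)

lemma emeasure_haar_on:
  "compact F \<Longrightarrow> B \<in> sets borel \<Longrightarrow> emeasure (haar_on F) B = emeasure m (F \<inter> B)"
  unfolding haar_on_def by (rule emeasure_restricted) (simp_all add: compact_borel)

lemma finite_measure_haar_on: "compact F \<Longrightarrow> finite_measure (haar_on F)"
  using fmeasurableD2[OF compact_fmeasurable]
  by (intro finite_measureI) (simp add: emeasure_haar_on)

lemma measure_haar_on_UNIV: "compact F \<Longrightarrow> measure (haar_on F) UNIV = measure m F"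
  by (simp add: measure_def emeasure_haar_on)

lemma emeasure_haar_on_cball_le: "compact F \<Longrightarrow> emeasure (haar_on F) (cball g R) \<le> ennreal (vol R)"
  unfolding emeasure_cball[of g, symmetric] by (simp add: emeasure_haar_on emeasure_mono)

lemma integral_haar_on:
  fixes u :: "'h \<Rightarrow> real"
  assumes "compact F" "u \<in> borel_measurable borel"
  shows "(\<integral>h. u h \<partial>haar_on F) = (LINT h:F|m. u h)"
proof -
  have "haar_on F = density m (\<lambda>h. ennreal (indicator F h))"
    unfolding haar_on_def by (simp add: ennreal_indicator)
  then show ?thesis
    unfolding set_lebesgue_integral_def using assms compact_borel[of F]
    by (simp add: integral_density)
qed

lemma compact_translate: "compact F \<Longrightarrow> compact ((\<lambda>x. x + h) ` F)" for F :: "'h set"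
proof (rule compact_continuous_image)
  have "continuous_on UNIV (\<lambda>x::'h. (x, h))"
    by (intro continuous_intros)
  then have "continuous_on UNIV ((\<lambda>p::'h \<times> 'h. fst p + snd p) \<circ> (\<lambda>x. (x, h)))"
    by (rule continuous_on_compose) (rule continuous_on_subset[OF continuous_plus], simp)
  then show "continuous_on F (\<lambda>x. x + h)"
    by (simp add: o_def) (rule continuous_on_subset, auto)
qed

definition overlap :: "'h set \<Rightarrow> 'h \<Rightarrow> real" where
  "overlap F h = measure m (F \<inter> (\<lambda>x. x + - h) ` F)"

lemma overlap_eq_integral:
  assumes "compact F"
  shows "overlap F h = (\<integral>g. indicat_real F (g + h) \<partial>haar_on F)"
proof -
  have eq: "(\<lambda>g. g + h) -` F = (\<lambda>x. x + - h) ` F"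
    by (force simp: add.assoc simp del: add_uminus_conv_diff)
  have "(\<integral>g. indicat_real F (g + h) \<partial>haar_on F)
      = (\<integral>g. indicat_real ((\<lambda>x. x + - h) ` F) g \<partial>haar_on F)"
    unfolding eq[symmetric] by (intro Bochner_Integration.integral_cong) (auto simp: indicator_def)
  also have "\<dots> = overlap F h"
    using emeasure_haar_on[OF assms compact_borel[OF compact_translate[OF assms]], of "- h"]
    by (simp add: overlap_def measure_def)
  finally show ?thesis by simp
qed

lemma overlap_measurable:
  assumes "compact F"
  shows "overlap F \<in> borel_measurable borel"
proof -
  interpret finite_measure "haar_on F" by (rule finite_measure_haar_on[OF assms])
  have [measurable]: "F \<in> sets borel" by (rule compact_borel[OF assms])
  have "(\<lambda>(h, g). indicat_real F (g + h)) \<in> borel_measurable (borel \<Otimes>\<^sub>M haar_on F)"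
    unfolding split_beta' by measurable
  then have "(\<lambda>h. \<integral>g. indicat_real F (g + h) \<partial>haar_on F) \<in> borel_measurable borel"
    by (rule borel_measurable_lebesgue_integral)
  moreover have "overlap F = (\<lambda>h. \<integral>g. indicat_real F (g + h) \<partial>haar_on F)"
    using overlap_eq_integral[OF assms] by auto
  ultimately show ?thesis by simp
qed

lemma integral_integral_haar_on_diff:
  fixes \<phi> :: "'h \<Rightarrow> real"
  assumes F: "compact F" and \<phi>: "integrable m \<phi>"
  shows "(\<integral>g. (\<integral>h. \<phi> (- g + h) \<partial>haar_on F) \<partial>haar_on F) = (\<integral>h. \<phi> h * overlap F h \<partial>m)"
proof -
  interpret \<nu>: finite_measure "haar_on F" by (rule finite_measure_haar_on[OF F])
  interpret pair: pair_sigma_finite "haar_on F" m by standard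
  have [measurable]: "F \<in> sets borel" by (rule compact_borel[OF F])
  have [measurable]: "\<phi> \<in> borel_measurable borel"
    using borel_measurable_integrable[OF \<phi>] by simp
  have integrable: "integrable (haar_on F \<Otimes>\<^sub>M m) (\<lambda>(g, h). \<phi> h * indicat_real F (g + h))"
  proof (rule Bochner_Integration.integrable_bound)
    show "integrable (haar_on F \<Otimes>\<^sub>M m) (\<lambda>(g, h). \<phi> h)"
      using \<phi> by (intro pair.Fubini_integrable) (auto simp: split_beta')
    show "(\<lambda>(g, h). \<phi> h * indicat_real F (g + h)) \<in> borel_measurable (haar_on F \<Otimes>\<^sub>M m)"
      unfolding split_beta' by measurable
  qed (auto simp: indicator_def)
  have "(\<integral>h. \<phi> (- g + h) \<partial>haar_on F) = (\<integral>h. \<phi> h * indicat_real F (g + h) \<partial>m)" for g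
  proof -
    have "(\<integral>h. \<phi> (- g + h) \<partial>haar_on F) = (\<integral>h. indicat_real F h * \<phi> (- g + h) \<partial>m)"
      by (subst integral_haar_on[OF F]) (simp_all add: set_lebesgue_integral_def)
    also have "\<dots> = (\<integral>h. indicat_real F (g + h) * \<phi> (- g + (g + h)) \<partial>m)"
      by (rule integral_translate[symmetric]) measurable
    finally show ?thesis
      by (simp add: add.assoc[symmetric] mult.commute)
  qed
  then have "(\<integral>g. (\<integral>h. \<phi> (- g + h) \<partial>haar_on F) \<partial>haar_on F)
      = (\<integral>h. (\<integral>g. \<phi> h * indicat_real F (g + h) \<partial>haar_on F) \<partial>m)"
    using pair.Fubini_integral[OF integrable] by simp
  then show ?thesis
    by (simp add: overlap_eq_integral[OF F])
qed

lemma overlap_le: "compact F \<Longrightarrow> overlap F h \<le> measure m F"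
  unfolding overlap_def
  by (intro measure_mono_fmeasurable fmeasurableD fmeasurable.Int compact_fmeasurable
      compact_translate Int_lower1)

lemma measure_le_overlap_plus_sym_diff:
  assumes "compact F"
  defines "F' h \<equiv> (\<lambda>x. x + - h) ` F"
  shows "measure m F \<le> overlap F h + measure m ((F - F' h) \<union> (F' h - F))"
proof -
  have F': "F' h \<in> fmeasurable m"
    unfolding F'_def by (intro compact_fmeasurable compact_translate assms)
  note fm = compact_fmeasurable[OF assms(1)] F'
  have "measure m F \<le> measure m ((F \<inter> F' h) \<union> ((F - F' h) \<union> (F' h - F)))"
    using fm
    by (intro measure_mono_fmeasurable fmeasurable.Un fmeasurable.Int fmeasurable.Diff) auto
  also have "\<dots> \<le> measure m (F \<inter> F' h) + measure m ((F - F' h) \<union> (F' h - F))"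
    using fm[THEN fmeasurableD] by (intro measure_Un_le) auto
  finally show ?thesis
    by (simp add: overlap_def F'_def)
qed

lemma folner_overlap_tendsto:
  assumes "right_folner m F"
  shows "(\<lambda>T. overlap (F T) h / measure m (F T)) \<longlonglongrightarrow> 1"
proof (rule tendsto_sandwich)
  have F: "compact (F T)" "measure m (F T) > 0" for T
    using assms by (auto simp: right_folner_def intro: measure_pos)
  let ?F' = "\<lambda>T. (\<lambda>x. x + - h) ` F T"
  let ?\<Delta> = "\<lambda>T. measure m ((F T - ?F' T) \<union> (?F' T - F T)) / measure m (F T)"
  have "?\<Delta> \<longlonglongrightarrow> 0"
    using assms unfolding right_folner_def by blast
  then have "(\<lambda>T. 1 - ?\<Delta> T) \<longlonglongrightarrow> 1 - 0"
    by (intro tendsto_intros)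
  then show "(\<lambda>T. 1 - ?\<Delta> T) \<longlonglongrightarrow> 1" by simp
  have "1 - ?\<Delta> T \<le> overlap (F T) h / measure m (F T)" for T
    using divide_right_mono[OF measure_le_overlap_plus_sym_diff[OF F(1)[of T], of h],
        of "measure m (F T)"] F(2)[of T]
    by (simp add: add_divide_distrib)
  then show "\<forall>\<^sub>F T in sequentially. 1 - ?\<Delta> T \<le> overlap (F T) h / measure m (F T)"
    by simp
  show "\<forall>\<^sub>F T in sequentially. overlap (F T) h / measure m (F T) \<le> 1"
    using overlap_le[OF F(1)] F(2) by simp
qed (rule tendsto_const)

end

locale subexponential_haar_group = haar_group m
  for m :: "'h::{metric_space, second_countable_topology, group_add} measure" +
  assumes subexp: "Limsup at_top (\<lambda>r. ereal (ln (measure m (ball 0 r)) / r)) = 0"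
begin

lemma vol_subexp:
  assumes "\<epsilon> > 0"
  obtains C where "C \<ge> 1" "\<And>R. R \<ge> 0 \<Longrightarrow> vol R \<le> C * exp (\<epsilon> * R)"
proof -
  have "Limsup at_top (\<lambda>r. ereal (ln (measure m (ball 0 r)) / r)) < ereal \<epsilon>"
    using assms by (simp add: subexp)
  then have "\<forall>\<^sub>F r in at_top. ereal (ln (measure m (ball 0 r)) / r) < ereal \<epsilon>"
    by (rule Limsup_lessD)
  then obtain r0 where r0: "\<And>r. r \<ge> r0 \<Longrightarrow> ln (measure m (ball 0 r)) / r < \<epsilon>"
    by (auto simp: eventually_at_top_linorder)
  define s where "s = max r0 0 + 1"
  have "vol R \<le> exp (\<epsilon> * s) * exp (\<epsilon> * R)" if "R \<ge> 0" for R
  proof -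
    let ?V = "measure m (ball 0 (R + s))"
    have "ball 0 (R + s) \<in> fmeasurable m"
      by (rule fmeasurableI2[OF compact_fmeasurable[OF compact_cball_0[of "R + s"]]]) auto
    then have "vol R \<le> ?V"
      unfolding vol_def by (intro measure_mono_fmeasurable) (auto simp: s_def)
    also have "?V \<le> exp (\<epsilon> * (R + s))"
    proof (cases "?V > 0")
      case True
      have "ln ?V \<le> \<epsilon> * (R + s)"
        using r0[of "R + s"] that by (simp add: s_def pos_divide_less_eq less_imp_le)
      then show ?thesis
        using True by (metis exp_le_cancel_iff exp_ln)
    next
      case False
      then show ?thesis using exp_ge_zero[of "\<epsilon> * (R + s)"] by linarith
    qed
    finally show ?thesis
      by (simp add: exp_add[symmetric] algebra_simps)
  qed
  then show ?thesis
    using assms by (intro that[of "exp (\<epsilon> * s)"]) (auto simp: s_def)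
qed

lemma vol_ln_le_powr:
  assumes "a \<ge> 0" "\<eta> > 0"
  obtains B where "B \<ge> 1" "\<And>V. V \<ge> 1 \<Longrightarrow> vol (a * ln V) \<le> B * V powr \<eta>"
proof -
  define \<epsilon> where "\<epsilon> = \<eta> / (a + 1)"
  have "\<epsilon> > 0" using assms by (simp add: \<epsilon>_def add_nonneg_pos)
  then obtain B where B: "B \<ge> 1" "\<And>R. R \<ge> 0 \<Longrightarrow> vol R \<le> B * exp (\<epsilon> * R)"
    by (rule vol_subexp) blast
  have "vol (a * ln V) \<le> B * V powr \<eta>" if V: "V \<ge> 1" for V
  proof -
    have "vol (a * ln V) \<le> B * exp (\<epsilon> * (a * ln V))"
      using assms V by (intro B) auto
    also have "\<epsilon> * a \<le> \<eta>"
      using assms by (simp add: \<epsilon>_def field_simps)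
    then have "\<epsilon> * (a * ln V) \<le> \<eta> * ln V"
      using mult_right_mono[of "\<epsilon> * a" \<eta> "ln V"] V by (simp add: mult.assoc)
    then have "B * exp (\<epsilon> * (a * ln V)) \<le> B * V powr \<eta>"
      using B(1) V by (simp add: powr_def)
    finally show ?thesis .
  qed
  with B(1) show ?thesis by (rule that)
qed

lemma summable_exp_mult_vol:
  assumes \<delta>: "\<delta> > 0"
  shows "summable (\<lambda>n. exp (- \<delta> * real n) * vol (real n + 1))"
proof -
  obtain B where B: "B \<ge> 1" "\<And>R. R \<ge> 0 \<Longrightarrow> vol R \<le> B * exp (\<delta> / 2 * R)"
    by (rule vol_subexp[of "\<delta> / 2"]) (use \<delta> in auto)
  have "summable (\<lambda>n. B * exp (\<delta> / 2) * exp (- \<delta> / 2) ^ n)"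
    using \<delta> by (intro summable_mult summable_geometric) simp
  moreover have "norm (exp (- \<delta> * real n) * vol (real n + 1))
      \<le> B * exp (\<delta> / 2) * exp (- \<delta> / 2) ^ n" for n
  proof -
    have "exp (- \<delta> * real n) * vol (real n + 1)
        \<le> exp (- \<delta> * real n) * (B * exp (\<delta> / 2 * (real n + 1)))"
      by (intro mult_left_mono B(2)) auto
    also have "\<dots> = B * exp (\<delta> / 2) * exp (- \<delta> / 2) ^ n"
      by (simp add: exp_of_nat_mult[symmetric] exp_add[symmetric] field_simps)
    finally show ?thesis by (simp add: vol_nonneg)
  qed
  ultimately show ?thesis
    by (rule summable_comparison_test'[where N = 0])
qed

lemma exp_dist_integrable:
  assumes \<delta>: "\<delta> > 0"
  shows "integrable m (\<lambda>h. exp (- \<delta> * dist h 0))"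
proof (rule integrableI_nonneg)
  define shell where "shell n h = ennreal (exp (- \<delta> * real n)) * indicator (cball 0 (real n + 1)) h"
    for n and h :: 'h
  have [measurable]: "cball (0::'h) R \<in> sets borel" for R
    by (simp add: borel_closed)
  have "ennreal (exp (- \<delta> * dist h 0)) \<le> (\<Sum>n. shell n h)" for h
  proof -
    define n where "n = nat \<lfloor>dist h 0\<rfloor>"
    have "real n = of_int \<lfloor>dist h 0\<rfloor>" by (simp add: n_def)
    then have "real n \<le> dist h 0" "dist h 0 \<le> real n + 1"
      using of_int_floor_le[of "dist h 0"] real_of_int_floor_add_one_ge[of "dist h 0"] by linarith+
    then have "ennreal (exp (- \<delta> * dist h 0)) \<le> shell n h"
      using \<delta> by (auto simp: shell_def indicator_def dist_commute intro!: ennreal_leI)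
    also have "\<dots> \<le> (\<Sum>n. shell n h)"
      using sum_le_suminf[of "\<lambda>n. shell n h" "{n}"] by simp
    finally show ?thesis .
  qed
  then have "(\<integral>\<^sup>+ h. ennreal (exp (- \<delta> * dist h 0)) \<partial>m) \<le> (\<integral>\<^sup>+ h. (\<Sum>n. shell n h) \<partial>m)"
    by (intro nn_integral_mono)
  also have "\<dots> = (\<Sum>n. \<integral>\<^sup>+ h. shell n h \<partial>m)"
    unfolding shell_def by (intro nn_integral_suminf) measurable
  also have "\<dots> = (\<Sum>n. ennreal (exp (- \<delta> * real n) * vol (real n + 1)))"
    by (intro suminf_cong)
      (simp add: shell_def nn_integral_cmult_indicator borel_closed emeasure_cball ennreal_mult
        vol_nonneg)
  also have "\<dots> < \<infinity>"
    using summable_exp_mult_vol[OF \<delta>] by (simp add: suminf_ennreal2 vol_nonneg)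
  finally show "(\<integral>\<^sup>+ h. ennreal (exp (- \<delta> * dist h 0)) \<partial>m) < \<infinity>" .
qed auto

end

subsection \<open>Moments of orbit integrals\<close>

locale haar_mixing_system = mixing_observable M act A N f + subexponential_haar_group m
  for M :: "'x measure"
    and act :: "'h::{metric_space, second_countable_topology, group_add} \<Rightarrow> 'x \<Rightarrow> 'x"
    and A :: "('x \<Rightarrow> real) set" and N :: "nat \<Rightarrow> ('x \<Rightarrow> real) \<Rightarrow> real" and f :: "'x \<Rightarrow> real"
    and m :: "'h measure" +
  assumes joint_meas: "(\<lambda>(h, x). act h x) \<in> measurable (m \<Otimes>\<^sub>M M) M"
begin

lemma act_uminus_measurable:
  assumes [measurable_cong]: "sets \<nu> = sets borel"
  shows "(\<lambda>p. act (- fst p) (snd p)) \<in> \<nu> \<Otimes>\<^sub>M M \<rightarrow>\<^sub>M M"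
proof -
  have "(\<lambda>p. (- fst p, snd p)) \<in> \<nu> \<Otimes>\<^sub>M M \<rightarrow>\<^sub>M m \<Otimes>\<^sub>M M"
    by measurable
  from measurable_compose[OF this joint_meas] show ?thesis by simp
qed

lemma f_trunc_act_measurable:
  assumes "sets \<nu> = sets borel"
  shows "(\<lambda>(h, x). f_trunc (act (- h) x)) \<in> borel_measurable (\<nu> \<Otimes>\<^sub>M M)"
  using measurable_compose[OF act_uminus_measurable[OF assms] f_trunc_measurable]
  by (simp add: split_beta')

lemma f_trunc_act_section: "x \<in> space M \<Longrightarrow> (\<lambda>h. f_trunc (act (- h) x)) \<in> borel_measurable borel"
  using measurable_compose[OF measurable_Pair2' f_trunc_act_measurable[OF refl]] by simp

definition orbit_integral :: "'h set \<Rightarrow> 'x \<Rightarrow> real" where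
  "orbit_integral F x = (\<integral>h. f_trunc (act (- h) x) \<partial>haar_on F)"

lemma orbit_integral_measurable:
  assumes "compact F"
  shows "orbit_integral F \<in> borel_measurable M"
proof -
  interpret finite_measure "haar_on F" by (rule finite_measure_haar_on[OF assms])
  have "(\<lambda>(x, h). f_trunc (act (- h) x)) \<in> borel_measurable (M \<Otimes>\<^sub>M haar_on F)"
    using measurable_compose[OF measurable_pair_swap' f_trunc_act_measurable[OF sets_haar_on]]
    by (simp add: split_beta')
  then show ?thesis
    unfolding orbit_integral_def by (rule borel_measurable_lebesgue_integral)
qed

lemma abs_orbit_integral_le:
  assumes "compact F"
  shows "\<bar>orbit_integral F x\<bar> \<le> ess_bound * measure m F"
proof -
  interpret finite_measure "haar_on F" by (rule finite_measure_haar_on[OF assms])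
  have "\<bar>orbit_integral F x\<bar> \<le> (\<integral>h. \<bar>f_trunc (act (- h) x)\<bar> \<partial>haar_on F)"
    unfolding orbit_integral_def by (rule integral_abs_bound)
  also have "\<dots> \<le> (\<integral>h. ess_bound \<partial>haar_on F)"
    using abs_f_trunc_le ess_bound(1) by (intro Bochner_Integration.integral_mono') auto
  also have "\<dots> = ess_bound * measure m F"
    by (simp add: measure_haar_on_UNIV[OF assms])
  finally show ?thesis .
qed

lemma orbit_integral_power_integrable:
  assumes "compact F"
  shows "integrable M (\<lambda>x. orbit_integral F x ^ k)"
proof (rule integrable_const_bound[of _ "(ess_bound * measure m F) ^ k"])
  show "AE x in M. norm (orbit_integral F x ^ k) \<le> (ess_bound * measure m F) ^ k"
    using abs_orbit_integral_le[OF assms] by (intro AE_I2) (simp add: power_abs power_mono)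
qed (use orbit_integral_measurable[OF assms] in auto)

lemma set_integral_orbit_measurable:
  assumes "compact F"
  shows "(\<lambda>x. LINT h:F|m. trans_fun act h f x) \<in> borel_measurable M"
proof -
  have [measurable]: "(\<lambda>p. act (- snd p) (fst p)) \<in> M \<Otimes>\<^sub>M m \<rightarrow>\<^sub>M M"
    using measurable_compose[OF measurable_pair_swap' act_uminus_measurable[OF sets_m]]
    by (simp add: split_beta')
  have [measurable]: "F \<in> sets borel" by (rule compact_borel[OF assms])
  have "(\<lambda>(x, h). indicator F h *\<^sub>R trans_fun act h f x) \<in> borel_measurable (M \<Otimes>\<^sub>M m)"
    unfolding trans_fun_def split_beta' by measurable
  then show ?thesis
    unfolding set_lebesgue_integral_def by (rule m.borel_measurable_lebesgue_integral)
qed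

lemma AE_set_integral_eq_orbit_integral:
  assumes "compact F"
  shows "AE x in M. (LINT h:F|m. trans_fun act h f x) = orbit_integral F x"
proof -
  interpret pair: pair_sigma_finite m M by standard
  note act_meas[measurable] = act_uminus_measurable[OF sets_m]
  have "{p \<in> space (m \<Otimes>\<^sub>M M). f (act (- fst p) (snd p)) = f_trunc (act (- fst p) (snd p))}
      \<in> sets (m \<Otimes>\<^sub>M M)"
    by measurable
  moreover have "AE h in m. AE x in M. f (act (- h) x) = f_trunc (act (- h) x)"
    using AE_trans_fun_eq_trunc by (simp add: trans_fun_def)
  ultimately have "AE x in M. AE h in m. f (act (- h) x) = f_trunc (act (- h) x)"
    using pair.AE_commute[of "\<lambda>h x. f (act (- h) x) = f_trunc (act (- h) x)"]
    by (simp add: split_beta')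
  moreover have "AE x in M. x \<in> space M" by simp
  ultimately show ?thesis
  proof eventually_elim
    case (elim x)
    have "(\<lambda>h. f (act (- h) x)) \<in> borel_measurable m"
      using measurable_compose[OF measurable_compose[OF measurable_Pair2'[OF elim(2)] act_meas]
          f_measurable]
      by simp
    then have "(LINT h:F|m. trans_fun act h f x) = (LINT h:F|m. f_trunc (act (- h) x))"
      using elim(1) compact_borel[OF assms] f_trunc_act_section[OF elim(2)]
      by (intro set_lebesgue_integral_cong_AE) (auto simp: trans_fun_def set_borel_measurable_def)
    then show ?case
      by (simp add: orbit_integral_def integral_haar_on[OF assms f_trunc_act_section[OF elim(2)]])
  qed
qed

lemma integral_mult_orbit_integral:
  assumes F: "compact F" and u: "u \<in> borel_measurable M" "\<And>x. \<bar>u x\<bar> \<le> B"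
  shows "(\<integral>x. u x * orbit_integral F x \<partial>M) = (\<integral>h. (\<integral>x. u x * f_trunc (act (- h) x) \<partial>M) \<partial>haar_on F)"
proof -
  interpret \<nu>: finite_measure "haar_on F" by (rule finite_measure_haar_on[OF F])
  interpret pair: pair_sigma_finite "haar_on F" M by standard
  interpret product: finite_measure "haar_on F \<Otimes>\<^sub>M M"
    by (intro finite_measure_pair_measure finite_measure_axioms \<nu>.finite_measure_axioms)
  have "B \<ge> 0" using u(2) abs_ge_zero order_trans by blast
  have [measurable]: "(\<lambda>p. act (- fst p) (snd p)) \<in> haar_on F \<Otimes>\<^sub>M M \<rightarrow>\<^sub>M M"
    by (rule act_uminus_measurable) simp
  note u(1)[measurable]
  have "integrable (haar_on F \<Otimes>\<^sub>M M) (\<lambda>(h, x). u x * f_trunc (act (- h) x))"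
  proof (rule product.integrable_const_bound[of _ "B * ess_bound"])
    show "AE p in haar_on F \<Otimes>\<^sub>M M.
        norm (case p of (h, x) \<Rightarrow> u x * f_trunc (act (- h) x)) \<le> B * ess_bound"
      using u(2) abs_f_trunc_le \<open>B \<ge> 0\<close> by (intro AE_I2) (auto simp: abs_mult intro!: mult_mono)
  qed (unfold split_beta', measurable)
  from pair.Fubini_integral[OF this] show ?thesis
    by (simp add: orbit_integral_def)
qed

lemma corr_cong: "(\<And>i. i \<in> I \<Longrightarrow> g i = h i) \<Longrightarrow> corr I g = corr I h"
  by (simp add: corr_def correlation_def)

lemma corr_measurable:
  assumes "compact F" "finite J" "I \<subseteq> J"
  shows "corr I \<in> borel_measurable (PiM J (\<lambda>_. haar_on F))"
proof -
  have "finite I" using assms(3,2) by (rule finite_subset)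
  have "(\<lambda>(h, x). \<Prod>i\<in>I. f_trunc (act (- h i) x)) \<in> borel_measurable (PiM I (\<lambda>_. haar_on F) \<Otimes>\<^sub>M M)"
    using integrable_PiM_pair_prod[where G = "\<lambda>_ h x. f_trunc (act (- h) x)",
        OF finite_measure_haar_on[OF assms(1)] finite_measure_axioms \<open>finite I\<close>
        f_trunc_act_measurable[OF sets_haar_on] abs_f_trunc_le]
    by (rule borel_measurable_integrable)
  then have "(\<lambda>h. \<integral>x. (\<Prod>i\<in>I. f_trunc (act (- h i) x)) \<partial>M)
      \<in> borel_measurable (PiM I (\<lambda>_. haar_on F))"
    by (rule borel_measurable_lebesgue_integral)
  from measurable_compose[OF measurable_restrict_subset[OF \<open>I \<subseteq> J\<close>] this] show ?thesis
    by (simp add: corr_eq_trunc[OF \<open>finite I\<close>, symmetric] cong: corr_cong)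
qed

lemma corr_mult_integrable:
  assumes "compact F" "finite J" "I \<subseteq> J" "K \<subseteq> J"
  shows "integrable (PiM J (\<lambda>_. haar_on F)) (\<lambda>h. corr I h * corr K h)"
proof -
  interpret finite_measure "PiM J (\<lambda>_. haar_on F)"
    by (intro finite_measure_PiM finite_measure_haar_on assms)
  show ?thesis
  proof (rule integrable_const_bound[of _ "corr_bound J * corr_bound J"])
    show "AE h in PiM J (\<lambda>_. haar_on F). norm (corr I h * corr K h) \<le> corr_bound J * corr_bound J"
      unfolding real_norm_def abs_mult using assms corr_bound_ge_1[of J]
      by (intro AE_I2 mult_mono abs_corr_le) auto
  qed (intro borel_measurable_times corr_measurable assms)
qed

lemma integral_corr:
  assumes "compact F" "finite J"
  shows "(\<integral>h. corr J h \<partial>PiM J (\<lambda>_. haar_on F)) = (\<integral>x. orbit_integral F x ^ card J \<partial>M)"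
  using integral_PiM_prod_swap[where G = "\<lambda>_ h x. f_trunc (act (- h) x)",
      OF finite_measure_haar_on[OF assms(1)] finite_measure_axioms assms(2)
      f_trunc_act_measurable[OF sets_haar_on] abs_f_trunc_le]
  by (simp add: corr_eq_trunc[OF assms(2)] orbit_integral_def)

lemma integral_corr_mult:
  assumes F: "compact F" and "finite I" "finite K" "I \<inter> K = {}"
  shows "(\<integral>h. corr I h * corr K h \<partial>PiM (I \<union> K) (\<lambda>_. haar_on F))
    = (\<integral>x. orbit_integral F x ^ card I \<partial>M) * (\<integral>x. orbit_integral F x ^ card K \<partial>M)"
proof -
  interpret finite_measure "haar_on F" by (rule finite_measure_haar_on[OF F])
  interpret product_sigma_finite "\<lambda>_. haar_on F" by standard
  have "corr I (merge I K (x, y)) = corr I x" "corr K (merge I K (x, y)) = corr K y" for x y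
    using assms(4) by (auto intro!: corr_cong simp: merge_def)
  then have "(\<integral>h. corr I h * corr K h \<partial>PiM (I \<union> K) (\<lambda>_. haar_on F))
      = (\<integral>x. (\<integral>y. corr I x * corr K y \<partial>PiM K (\<lambda>_. haar_on F)) \<partial>PiM I (\<lambda>_. haar_on F))"
    using product_integral_fold[OF assms(4,2,3) corr_mult_integrable[OF F]] assms by simp
  then show ?thesis
    by (simp add: integral_corr assms)
qed

lemma integral_pairing_sum:
  assumes F: "compact F" and J: "finite J" "i \<in> J"
  shows "integrable (PiM J (\<lambda>_. haar_on F)) (pairing_sum i J)"
    and "(\<integral>h. pairing_sum i J h \<partial>PiM J (\<lambda>_. haar_on F)) = real (card J - 1)
      * ((\<integral>x. orbit_integral F x ^ 2 \<partial>M) * (\<integral>x. orbit_integral F x ^ (card J - 2) \<partial>M))"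
proof -
  have int: "integrable (PiM J (\<lambda>_. haar_on F)) (\<lambda>h. corr {i, j} h * corr (J - {i, j}) h)"
    if "j \<in> J" for j
    using that J by (intro corr_mult_integrable F) auto
  show "integrable (PiM J (\<lambda>_. haar_on F)) (pairing_sum i J)"
    unfolding pairing_sum_def[abs_def] using int by (intro Bochner_Integration.integrable_sum) auto
  have "(\<integral>h. corr {i, j} h * corr (J - {i, j}) h \<partial>PiM J (\<lambda>_. haar_on F))
      = (\<integral>x. orbit_integral F x ^ 2 \<partial>M) * (\<integral>x. orbit_integral F x ^ (card J - 2) \<partial>M)"
    if "j \<in> J - {i}" for j
  proof -
    have "{i, j} \<union> (J - {i, j}) = J" "card {i, j} = 2" "card (J - {i, j}) = card J - 2"
      using that J by (auto simp: card_Diff_subset)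
    then show ?thesis
      using integral_corr_mult[OF F, of "{i, j}" "J - {i, j}"] J by simp
  qed
  then show "(\<integral>h. pairing_sum i J h \<partial>PiM J (\<lambda>_. haar_on F)) = real (card J - 1)
      * ((\<integral>x. orbit_integral F x ^ 2 \<partial>M) * (\<integral>x. orbit_integral F x ^ (card J - 2) \<partial>M))"
    unfolding pairing_sum_def using J int by (subst Bochner_Integration.integral_sum) auto
qed

definition recursion_defect :: "nat \<Rightarrow> 'h set \<Rightarrow> real" where
  "recursion_defect r F = (\<integral>x. orbit_integral F x ^ r \<partial>M) - real (r - 1)
    * ((\<integral>x. orbit_integral F x ^ 2 \<partial>M) * (\<integral>x. orbit_integral F x ^ (r - 2) \<partial>M))"

lemma recursion_defect_eq_integral:
  assumes F: "compact F" and J: "finite J" "i \<in> J"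
  shows "recursion_defect (card J) F = (\<integral>h. corr J h - pairing_sum i J h \<partial>PiM J (\<lambda>_. haar_on F))"
    and "integrable (PiM J (\<lambda>_. haar_on F)) (\<lambda>h. corr J h - pairing_sum i J h)"
proof -
  have int: "integrable (PiM J (\<lambda>_. haar_on F)) (corr J)"
    using corr_mult_integrable[OF F J(1), of J "{}"] by (simp add: corr_empty)
  note int_diff = int integral_pairing_sum(1)[OF F J]
  show "recursion_defect (card J) F = (\<integral>h. corr J h - pairing_sum i J h \<partial>PiM J (\<lambda>_. haar_on F))"
    by (simp add: recursion_defect_def Bochner_Integration.integral_diff[OF int_diff]
        integral_corr[OF F J(1)] integral_pairing_sum(2)[OF F J])
  show "integrable (PiM J (\<lambda>_. haar_on F)) (\<lambda>h. corr J h - pairing_sum i J h)"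
    by (rule Bochner_Integration.integrable_diff[OF int_diff])
qed

lemma abs_recursion_defect_le:
  fixes J :: "'i set"
  assumes J: "finite J" "i \<in> J"
  obtains C L where "C \<ge> 0" "L \<ge> 0" "\<And>F D. compact F \<Longrightarrow> D \<ge> 0 \<Longrightarrow> \<bar>recursion_defect (card J) F\<bar>
    \<le> C * (exp (- D) * measure m F ^ card J + tethered_weight J (measure m F) (vol (L * D)))"
proof -
  obtain C L where C: "C \<ge> 0" and L: "L \<ge> 0" and recursion: "\<And>h D. D \<ge> 0 \<Longrightarrow>
      \<bar>corr J h - pairing_sum i J h\<bar>
        \<le> C * (exp (- D) + tethered_count (L * D) J h)"
    by (rule corr_recursion[OF J]) blast
  have "\<bar>recursion_defect (card J) F\<bar>
      \<le> C * (exp (- D) * measure m F ^ card J + tethered_weight J (measure m F) (vol (L * D)))"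
    if F: "compact F" and D: "D \<ge> 0" for F D
  proof -
    let ?\<Pi> = "PiM J (\<lambda>_. haar_on F)"
    note fin = finite_measure_haar_on[OF F]
    interpret \<Pi>: finite_measure ?\<Pi> by (rule finite_measure_PiM[OF fin J(1)])
    note defect = recursion_defect_eq_integral[OF F J]
    note count = integral_tethered_count_le[OF fin sets_haar_on emeasure_haar_on_cball_le[OF F]
        vol_nonneg J(1), of "L * D"]
    have "measure ?\<Pi> (space ?\<Pi>) = measure m F ^ card J"
      by (subst measure_space_PiM) (simp_all add: fin J(1) measure_haar_on_UNIV[OF F])
    have "\<bar>recursion_defect (card J) F\<bar> \<le> (\<integral>h. \<bar>corr J h - pairing_sum i J h\<bar> \<partial>?\<Pi>)"
      using defect(1) integral_abs_bound[of ?\<Pi>] by simp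
    also have "\<dots> \<le> (\<integral>h. C * (exp (- D) + tethered_count (L * D) J h) \<partial>?\<Pi>)"
      using recursion[OF D] count(1)
      by (intro integral_mono integrable_abs defect(2) integrable_mult_right
          Bochner_Integration.integrable_add) auto
    also have "\<dots> = C * (exp (- D) * measure m F ^ card J + (\<integral>h. tethered_count (L * D) J h \<partial>?\<Pi>))"
      using \<open>measure ?\<Pi> (space ?\<Pi>) = measure m F ^ card J\<close>
        Bochner_Integration.integral_add[OF \<Pi>.integrable_const count(1), of "exp (- D)"]
      by (simp add: mult.commute)
    also have "\<dots>
        \<le> C * (exp (- D) * measure m F ^ card J + tethered_weight J (measure m F) (vol (L * D)))"
      using count(2) C
      by (intro mult_left_mono add_left_mono) (simp_all add: measure_haar_on_UNIV[OF F])
    finally show ?thesis .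
  qed
  with C L show ?thesis by (rule that)
qed

lemma abs_recursion_defect_le_powr:
  assumes r: "r \<ge> 1"
  obtains K where "\<And>F. compact F \<Longrightarrow> measure m F \<ge> 1 \<Longrightarrow>
    \<bar>recursion_defect r F\<bar> \<le> K * measure m F powr (r / 2 - 1 / 4)"
proof -
  obtain C L where C: "C \<ge> 0" and L: "L \<ge> 0" and defect: "\<And>F D. compact F \<Longrightarrow> D \<ge> 0 \<Longrightarrow>
      \<bar>recursion_defect r F\<bar>
        \<le> C * (exp (- D) * measure m F ^ r + tethered_weight {..<r} (measure m F) (vol (L * D)))"
    by (rule abs_recursion_defect_le[of "{..<r}" 0]) (use r in auto)
  obtain B where B: "B \<ge> 1" "\<And>V. V \<ge> 1 \<Longrightarrow> vol (L * r * ln V) \<le> B * V powr (1 / (4 * r))"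
    by (rule vol_ln_le_powr[of "L * r" "1 / (4 * r)"]) (use L r in auto)
  define n where "n = real (card (sparse_retractions {..<r}))"
  have "\<bar>recursion_defect r F\<bar> \<le> C * (1 + n * B ^ r) * measure m F powr (r / 2 - 1 / 4)"
    if F: "compact F" and V: "measure m F \<ge> 1" for F
  proof -
    let ?V = "measure m F"
    \<comment> \<open>The mixing error is then bounded while balls of radius L D have subpolynomial volume.\<close>
    define D where "D = r * ln ?V"
    have "D \<ge> 0" using V by (simp add: D_def)
    have "exp (- D) * ?V ^ r = 1"
      using V by (simp add: D_def exp_minus exp_of_nat_mult)
    also have "1 \<le> ?V powr (r / 2 - 1 / 4)"
      using V r by (intro ge_one_powr_ge_zero) (auto simp: field_simps)
    finally have "exp (- D) * ?V ^ r \<le> ?V powr (r / 2 - 1 / 4)" .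
    moreover have "tethered_weight {..<r} ?V (vol (L * D)) \<le> n * (B ^ r * ?V powr (r / 2 - 1 / 4))"
      using tethered_weight_le_powr[OF V B(1) vol_nonneg, of "L * D" "{..<r}"] B(2)[OF V]
      by (simp add: n_def D_def mult.assoc)
    ultimately have "C * (exp (- D) * ?V ^ r + tethered_weight {..<r} ?V (vol (L * D)))
        \<le> C * (?V powr (r / 2 - 1 / 4) + n * (B ^ r * ?V powr (r / 2 - 1 / 4)))"
      by (intro mult_left_mono add_mono C)
    then show ?thesis
      using defect[OF F \<open>D \<ge> 0\<close>] by (simp add: algebra_simps)
  qed
  then show ?thesis by (rule that)
qed

definition moment :: "nat \<Rightarrow> 'h set \<Rightarrow> real" where
  "moment k F = (\<integral>x. (orbit_integral F x / sqrt (measure m F)) ^ k \<partial>M)"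

lemma moment_eq: "moment k F = (\<integral>x. orbit_integral F x ^ k \<partial>M) / sqrt (measure m F) ^ k"
  by (simp add: moment_def power_divide)

lemma moment_recursion_defect:
  assumes "r \<ge> 1"
  shows "moment r F - real (r - 1) * (moment 2 F * moment (r - 2) F)
    = recursion_defect r F / sqrt (measure m F) ^ r"
proof (cases "r = 1")
  case True
  then show ?thesis by (simp add: moment_eq recursion_defect_def)
next
  case False
  then have "sqrt (measure m F) ^ r = sqrt (measure m F) ^ 2 * sqrt (measure m F) ^ (r - 2)"
    using assms
    by (metis One_nat_def Suc_1 Suc_leI le_add_diff_inverse le_neq_implies_less power_add)
  then show ?thesis
    by (simp add: moment_eq recursion_defect_def diff_divide_distrib)
qed

lemma moment_recursion_tendsto:
  assumes r: "r \<ge> 1" and F: "\<And>T. compact (F T)"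
    and big: "filterlim (\<lambda>T. measure m (F T)) at_top sequentially"
  shows "(\<lambda>T. moment r (F T) - real (r - 1) * (moment 2 (F T) * moment (r - 2) (F T))) \<longlonglongrightarrow> 0"
proof -
  obtain K where K: "\<And>F. compact F \<Longrightarrow> measure m F \<ge> 1 \<Longrightarrow>
      \<bar>recursion_defect r F\<bar> \<le> K * measure m F powr (r / 2 - 1 / 4)"
    by (rule abs_recursion_defect_le_powr[OF r]) blast
  have bound: "\<bar>recursion_defect r F / sqrt (measure m F) ^ r\<bar> \<le> K * measure m F powr (- (1 / 4))"
    if "compact F" "measure m F \<ge> 1" for F
  proof -
    have sqrt: "sqrt (measure m F) ^ r = measure m F powr (r / 2)"
      using that by (simp add: powr_half_sqrt[symmetric] powr_power)
    have "\<bar>recursion_defect r F / sqrt (measure m F) ^ r\<bar>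
        \<le> K * measure m F powr (r / 2 - 1 / 4) / measure m F powr (r / 2)"
      unfolding sqrt abs_divide using K[OF that] by (simp add: divide_right_mono)
    also have "\<dots> = K * measure m F powr (r / 2 - 1 / 4 - r / 2)"
      by (simp only: powr_diff times_divide_eq_right)
    finally show ?thesis by simp
  qed
  have "(\<lambda>T. measure m (F T) powr (- (1 / 4))) \<longlonglongrightarrow> 0"
    by (rule tendsto_neg_powr[OF _ big]) simp
  then have "(\<lambda>T. K * measure m (F T) powr (- (1 / 4))) \<longlonglongrightarrow> 0"
    by (rule tendsto_mult_right_zero)
  moreover have "\<forall>\<^sub>F T in sequentially. measure m (F T) \<ge> 1"
    using big by (simp add: filterlim_at_top)
  then have "\<forall>\<^sub>F T in sequentially.
      norm (recursion_defect r (F T) / sqrt (measure m (F T)) ^ r)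
        \<le> K * measure m (F T) powr (- (1 / 4))"
    by eventually_elim (use bound[OF F] in simp)
  ultimately show ?thesis
    unfolding moment_recursion_defect[OF r] by (rule Lim_null_comparison[rotated])
qed

subsection \<open>The second moment\<close>

definition cov :: "'h \<Rightarrow> real" where
  "cov h = (\<integral>x. f x * trans_fun act h f x \<partial>M)"

lemma cov_diff_eq_corr: "cov (- g + h) = corr {0, Suc 0} (\<lambda>i. if i = 0 then g else h)"
proof -
  have trans_0: "trans_fun act 0 f = f"
    using action by (simp add: trans_fun_def group_action_def)
  have "corr {0, Suc 0} (\<lambda>i. if i = 0 then g else h)
      = expectation (\<lambda>x. \<Prod>i\<in>{0, Suc 0}. trans_fun act (- g + (if i = 0 then g else h)) f x)"
    unfolding corr_def by (rule expectation_prod_recentre[OF fA, symmetric])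
  then show ?thesis
    by (simp add: cov_def trans_0)
qed

lemma cov_diff_eq_trunc: "cov (- g + h) = (\<integral>x. f_trunc (act (- g) x) * f_trunc (act (- h) x) \<partial>M)"
  unfolding cov_diff_eq_corr by (subst corr_eq_trunc) simp_all

lemma cov_measurable[measurable]: "cov \<in> borel_measurable borel"
proof -
  have [measurable]: "(\<lambda>p. act (- fst p) (snd p)) \<in> borel \<Otimes>\<^sub>M M \<rightarrow>\<^sub>M M"
    by (rule act_uminus_measurable) simp
  have "(\<lambda>(h, x). f_trunc (act (- 0) x) * f_trunc (act (- h) x)) \<in> borel_measurable (borel \<Otimes>\<^sub>M M)"
    unfolding split_beta' by measurable
  then have "(\<lambda>h. \<integral>x. f_trunc (act (- 0) x) * f_trunc (act (- h) x) \<partial>M) \<in> borel_measurable borel"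
    by (rule borel_measurable_lebesgue_integral)
  moreover have "cov = (\<lambda>h. \<integral>x. f_trunc (act (- 0) x) * f_trunc (act (- h) x) \<partial>M)"
    using cov_diff_eq_trunc[of 0] by auto
  ultimately show ?thesis by simp
qed

lemma cov_exp_decay:
  obtains \<delta> C where "\<delta> > 0" "\<And>h. \<bar>cov h\<bar> \<le> C * exp (- \<delta> * dist h 0)"
proof -
  obtain \<delta> s C where "\<delta> > 0" and decay: "\<And>(I :: nat set) u g L. finite I \<Longrightarrow> card I \<le> 2 \<Longrightarrow> 0 \<le> L \<Longrightarrow>
      (\<And>i. i \<in> I \<Longrightarrow> u i \<in> A) \<Longrightarrow> pairwise (\<lambda>i j. L \<le> dist (g i) (g j)) I \<Longrightarrow>
      mixing_defect I u g \<le> C * exp (- \<delta> * L) * (\<Prod>i\<in>I. N s (u i))"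
    by (rule mixing_defect_decay[of 2]) blast
  have "\<bar>cov h\<bar> \<le> C * (N s f * N s f) * exp (- \<delta> * dist h 0)" for h
    using decay[of "{0, Suc 0}" "dist h 0" "\<lambda>_. f" "\<lambda>i. if i = 0 then 0 else h"]
      cov_diff_eq_corr[of 0 h]
    by (simp add: mixing_defect_def corr_def fA mean0 pairwise_def dist_commute mult_ac)
  with \<open>\<delta> > 0\<close> show ?thesis by (rule that)
qed

lemma cov_integrable: "integrable m cov"
proof -
  obtain \<delta> C where \<delta>: "\<delta> > 0" and C: "\<And>h. \<bar>cov h\<bar> \<le> C * exp (- \<delta> * dist h 0)"
    by (rule cov_exp_decay) blast
  show ?thesis
  proof (rule Bochner_Integration.integrable_bound)
    show "integrable m (\<lambda>h. C * exp (- \<delta> * dist h 0))"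
      by (rule integrable_mult_right[OF exp_dist_integrable[OF \<delta>]])
  qed (use C order_trans[OF C abs_ge_self] in auto)
qed

lemma second_moment_eq:
  assumes "compact F"
  shows "(\<integral>x. orbit_integral F x ^ 2 \<partial>M) = (\<integral>h. cov h * overlap F h \<partial>m)"
proof -
  have "(\<integral>x. orbit_integral F x * f_trunc (act (- g) x) \<partial>M) = (\<integral>h. cov (- g + h) \<partial>haar_on F)" for g
  proof -
    have "(\<integral>x. orbit_integral F x * f_trunc (act (- g) x) \<partial>M)
        = (\<integral>x. f_trunc (act (- g) x) * orbit_integral F x \<partial>M)"
      by (simp add: mult.commute)
    also have "\<dots> = (\<integral>h. (\<integral>x. f_trunc (act (- g) x) * f_trunc (act (- h) x) \<partial>M) \<partial>haar_on F)"
      by (intro integral_mult_orbit_integral[OF assms, of _ ess_bound] abs_f_trunc_le) simp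
    finally show ?thesis
      by (simp add: cov_diff_eq_trunc)
  qed
  then have "(\<integral>x. orbit_integral F x * orbit_integral F x \<partial>M)
      = (\<integral>g. (\<integral>h. cov (- g + h) \<partial>haar_on F) \<partial>haar_on F)"
    using integral_mult_orbit_integral[OF assms orbit_integral_measurable[OF assms]
        abs_orbit_integral_le[OF assms]]
    by simp
  then show ?thesis
    by (simp add: power2_eq_square integral_integral_haar_on_diff[OF assms cov_integrable])
qed

lemma second_moment_tendsto:
  assumes folner: "right_folner m F"
  shows "(\<lambda>T. moment 2 (F T)) \<longlonglongrightarrow> (\<integral>h. cov h \<partial>m)"
proof -
  have F: "compact (F T)" for T
    using folner by (simp add: right_folner_def)
  let ?ratio = "\<lambda>T h. overlap (F T) h / measure m (F T)"
  have "(\<lambda>T. \<integral>h. cov h * ?ratio T h \<partial>m) \<longlonglongrightarrow> (\<integral>h. cov h \<partial>m)"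
  proof (rule integral_dominated_convergence[where w = "\<lambda>h. \<bar>cov h\<bar>"])
    show "(\<lambda>h. cov h * ?ratio T h) \<in> borel_measurable m" for T
      using overlap_measurable[OF F, of T] by simp
    show "AE h in m. norm (cov h * ?ratio T h) \<le> \<bar>cov h\<bar>" for T
    proof (rule AE_I2)
      fix h
      have "\<bar>?ratio T h\<bar> \<le> 1"
        using overlap_le[OF F, of T h] by (simp add: overlap_def divide_le_eq_1 less_le)
      then show "norm (cov h * ?ratio T h) \<le> \<bar>cov h\<bar>"
        using mult_left_le[of _ "\<bar>cov h\<bar>"] by (simp only: real_norm_def abs_mult abs_ge_zero)
    qed
    have "(\<lambda>T. cov h * ?ratio T h) \<longlonglongrightarrow> cov h * 1" for h
      by (intro tendsto_intros folner_overlap_tendsto folner)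
    then show "AE h in m. (\<lambda>T. cov h * ?ratio T h) \<longlonglongrightarrow> cov h"
      by simp
  qed (use cov_integrable in auto)
  moreover have "moment 2 (F T) = (\<integral>h. cov h * ?ratio T h \<partial>m)" for T
    unfolding moment_eq second_moment_eq[OF F] by simp
  ultimately show ?thesis by simp
qed

lemma integral_cov_nonneg:
  assumes "right_folner m F"
  shows "0 \<le> (\<integral>h. cov h \<partial>m)"
  by (rule LIMSEQ_le_const[OF second_moment_tendsto[OF assms]]) (simp add: moment_def)

subsection \<open>The central limit theorem\<close>

lemma moment_tendsto:
  assumes folner: "right_folner m F"
    and big: "filterlim (\<lambda>T. measure m (F T)) at_top sequentially"
  shows "(\<lambda>T. moment k (F T)) \<longlonglongrightarrow> (\<integral>x. x ^ k \<partial>normal_law (\<integral>h. cov h \<partial>m))"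
proof -
  define v where "v = (\<integral>h. cov h \<partial>m)"
  have v: "v \<ge> 0" unfolding v_def by (rule integral_cov_nonneg[OF folner])
  interpret normal: real_distribution "normal_law v" by (rule real_distribution_normal_law[OF v])
  have F: "compact (F T)" for T
    using folner by (simp add: right_folner_def)
  note recursion = moment_recursion_tendsto[OF _ F big]
  have "(\<lambda>T. moment k (F T)) \<longlonglongrightarrow> (\<integral>x. x ^ k \<partial>normal_law v)"
  proof (induction k rule: induct_nat_012)
    case 0
    show ?case using normal.prob_space by (simp add: moment_def prob_space)
  next
    case 1
    have "(\<integral>x. x ^ Suc 0 \<partial>normal_law v) = 0"
      using has_bochner_integral_integral_eq[OF normal_law_moment_odd[OF v, of 0]] by simp
    then show ?case
      using recursion[of 1] by simp
  next
    case (ge2 k)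
    have "(\<lambda>T. (moment (Suc (Suc k)) (F T) - real (Suc k) * (moment 2 (F T) * moment k (F T)))
        + real (Suc k) * (moment 2 (F T) * moment k (F T)))
        \<longlonglongrightarrow> 0 + real (Suc k) * (v * (\<integral>x. x ^ k \<partial>normal_law v))"
      using recursion[of "Suc (Suc k)"] ge2 second_moment_tendsto[OF folner]
      by (intro tendsto_intros) (auto simp: v_def)
    then show ?case
      by (simp add: normal_law_moment_recursion[OF v] del: power_Suc)
  qed
  then show ?thesis by (simp add: v_def)
qed

lemma orbit_integral_weak_conv_normal_law:
  assumes folner: "right_folner m F"
    and big: "filterlim (\<lambda>T. measure m (F T)) at_top sequentially"
  shows "weak_conv_m (\<lambda>T. distr M borel (\<lambda>x. orbit_integral (F T) x / sqrt (measure m (F T))))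
    (normal_law (\<integral>h. cov h \<partial>m))"
proof (rule weak_conv_m_normal_law_of_moments)
  have F: "compact (F T)" for T
    using folner by (simp add: right_folner_def)
  show "(\<lambda>x. orbit_integral (F T) x / sqrt (measure m (F T))) \<in> borel_measurable M" for T
    using orbit_integral_measurable[OF F] by simp
  show "integrable M (\<lambda>x. (orbit_integral (F T) x / sqrt (measure m (F T))) ^ k)" for T k
    using orbit_integral_power_integrable[OF F] by (simp add: power_divide)
  show "(\<lambda>T. expectation (\<lambda>x. (orbit_integral (F T) x / sqrt (measure m (F T))) ^ k))
      \<longlonglongrightarrow> (\<integral>x. x ^ k \<partial>normal_law (\<integral>h. cov h \<partial>m))" for k
    using moment_tendsto[OF folner big] by (simp add: moment_def)
qed (rule integral_cov_nonneg[OF folner])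

lemma distr_set_integral_eq_orbit_integral:
  assumes "compact F"
  shows "distr M borel (\<lambda>x. (LINT h:F|m. trans_fun act h f x) / c)
    = distr M borel (\<lambda>x. orbit_integral F x / c)"
proof (rule distr_cong_AE)
  show "AE x in M. (LINT h:F|m. trans_fun act h f x) / c = orbit_integral F x / c"
    using AE_set_integral_eq_orbit_integral[OF assms] by eventually_elim simp
qed (use set_integral_orbit_measurable[OF assms] orbit_integral_measurable[OF assms] in auto)

end

theorem theorem1p1:
  fixes m :: "'h::{metric_space, second_countable_topology, group_add} measure"
    and M :: "'x measure" and act :: "'h \<Rightarrow> 'x \<Rightarrow> 'x"
    and A :: "('x \<Rightarrow> real) set" and N :: "nat \<Rightarrow> ('x \<Rightarrow> real) \<Rightarrow> real"
    and F :: "nat \<Rightarrow> 'h set" and f :: "'x \<Rightarrow> real"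
  assumes topgrp_add: "continuous_on UNIV (\<lambda>p::'h \<times> 'h. fst p + snd p)"
    and topgrp_inv: "continuous_on UNIV (uminus :: 'h \<Rightarrow> 'h)"
    and left_inv_metric: "\<forall>g x y::'h. dist (g + x) (g + y) = dist x y"
    and proper_metric: "\<forall>r. compact (cball (0::'h) r)"
    and haar: "left_haar m"
    and subexp: "Limsup at_top (\<lambda>r. ereal (ln (measure m (ball 0 r)) / r)) = 0"
    and folner: "right_folner m F"
    and folner_big: "filterlim (\<lambda>T. measure m (F T)) at_top sequentially"
    and prob: "prob_space M"
    and action: "group_action act"
    and joint_meas: "(\<lambda>(h, x). act h x) \<in> measurable (m \<Otimes>\<^sub>M M) M"
    and mpres: "\<forall>h. act h \<in> M \<rightarrow>\<^sub>M M \<and> distr M M (act h) = M"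
    and alg: "inv_subalgebra M act A"
    and seminorms: "adm_seminorms M act A N"
    and mixing: "exp_mixing_all_orders M act A N"
    and fA: "f \<in> A"
    and mean0: "(\<integral>x. f x \<partial>M) = 0"
  shows "weak_conv_m
     (\<lambda>T. distr M borel (\<lambda>x. (LINT h:F T|m. trans_fun act h f x) / sqrt (measure m (F T))))
     (normal_law (LINT h|m. (\<integral>x. f x * trans_fun act h f x \<partial>M)))"
proof -
  interpret prob_space M by (rule prob)
  interpret haar_mixing_system M act A N f m
    using assms by unfold_locales auto
  have "compact (F T)" for T
    using folner by (simp add: right_folner_def)
  then show ?thesis
    using orbit_integral_weak_conv_normal_law[OF folner folner_big]
    by (simp add: distr_set_integral_eq_orbit_integral cov_def)
qed

end
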